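(* Given a Boolean dynamical system $(\mathcal{B},\mathcal{L},\theta)$, there exists a unique universal representation of $(\mathcal{B},\mathcal{L},\theta)$. (The associated $C^*$-algebra $C^*(\mathcal{B},\mathcal{L},\theta)$, i.e. the $C^*$-algebra $C^*(p_A,s_\alpha)$ generated by the universal representation $\{p_A,s_\alpha\}$, is called the Cuntz-Krieger Boolean algebra of the Boolean dynamical system $(\mathcal{B},\mathcal{L},\theta)$.)
   Context: A Boolean algebra $\mathcal{B}$ here is a set with a distinguished element $\emptyset$ and operations $\cap,\cup,\setminus$ (intersection, union, relative complement) satisfying the standard axioms (a Boolean ring; no top element is required). Write $A\subseteq B$ iff $A\cap B=A$. An action on $\mathcal{B}$ is a map $\theta:\mathcal{B}\to\mathcal{B}$ preserving $\cap,\cup,\setminus$ with $\theta(\emptyset)=\emptyset$. It has compact range if $\{\theta(A)\}_{A\in\mathcal{B}}$ has a least upper bound $\mathcal{R}_\theta\in\mathcal{B}$, and closed domain if there is $\mathcal{D}_\theta\in\mathcal{B}$ with $\theta(\mathcal{D}_\theta)=\mathcal{R}_\theta$ (one such element is fixed). A Boolean dynamical system $(\mathcal{B},\mathcal{L},\theta)$ consists of a Boolean algebra $\mathcal{B}$, a set $\mathcal{L}$ and actions $\{\theta_\alpha\}_{\alpha\in\mathcal{L}}$ on $\mathcal{B}$ such that for every word $\alpha=\alpha_1\cdots\alpha_n$, $n\ge 1$, in $\mathcal{L}$ the action $\theta_\alpha=\theta_{\alpha_n}\circ\cdots\circ\theta_{\alpha_1}$ has compact range and closed domain; write $\mathcal{R}_\alpha=\mathcal{R}_{\theta_\alpha}$,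 $\mathcal{D}_\alpha=\mathcal{D}_{\theta_\alpha}$. For $B\in\mathcal{B}$ put $\Delta_B=\{\alpha\in\mathcal{L}:\theta_\alpha(B)\ne\emptyset\}$ and $\lambda_B=|\Delta_B|$. An element $A\in\mathcal{B}$ is regular if $0<\lambda_B<\infty$ for every $\emptyset\neq B\in\mathcal{B}$ with $B\subseteq A$; $\mathcal{B}_{reg}$ is the set of regular elements (including $\emptyset$). A (Cuntz-Krieger) representation of $(\mathcal{B},\mathcal{L},\theta)$ in a $C^*$-algebra $\mathcal{A}$ is a family of projections $\{P_A\}_{A\in\mathcal{B}}$ and partial isometries $\{S_\alpha\}_{\alpha\in\mathcal{L}}$ in $\mathcal{A}$ such that: (1) $P_AP_B=P_{A\cap B}$ and $P_{A\cup B}=P_A+P_B-P_{A\cap B}$ for $A,B\in\mathcal{B}$, where $P_\emptyset=0$; (2) $P_AS_\alpha=S_\alpha P_{\theta_\alpha(A)}$ for $\alpha\in\mathcal{L}$, $A\in\mathcal{B}$; (3) $S_\alpha^*S_\beta=\delta_{\alpha,\beta}P_{\mathcal{R}_\alpha}$ for $\alpha,\beta\in\mathcal{L}$; (4) $P_A=\sum_{\alpha\in\Delta_A}S_\alpha P_{\theta_\alpha(A)}S_\alpha^*$ for $A\in\mathcal{B}_{reg}$. $C^*(P_A,S_\alpha)$ denotes the $C^*$-subalgebra of $\mathcal{A}$ generated by all the $P_A$ and $S_\alpha$. A universal representation $\{p_A,s_\alpha\}$ of $(\mathcal{B},\mathcal{L},\theta)$ is a representation with the following universal property: given a representation $\{P_A,S_\alpha\}$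 of $(\mathcal{B},\mathcal{L},\theta)$ in a $C^*$-algebra $\mathcal{A}$, there exists a non-degenerate $*$-homomorphism $\pi_{S,P}:C^*(p_A,s_\alpha)\to\mathcal{A}$ such that $\pi_{S,P}(p_A)=P_A$ and $\pi_{S,P}(s_\alpha)=S_\alpha$ for all $A\in\mathcal{B}$ and $\alpha\in\mathcal{L}$. One sets $C^*(\mathcal{B},\mathcal{L},\theta):=C^*(p_A,s_\alpha)$.
   Formalization: Non-degeneracy of the homomorphism is required relative to the C*-subalgebra generated by the P_A and S_α, not the whole target algebra, since the zero representation in the complex numbers would otherwise rule out every universal representation. *)

theory Defs
  imports
    "HOL-Algebra.Algebraic_Closure_Type"
    "HOL-Library.Lub_Glb"
    "HOL-Analysis.Abstract_Metric_Spaces"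
begin

text \<open>
  Boolean algebras without a top element (Boolean rings). The empty set is \<^term>\<open>bot\<close>, and
  intersection, union and relative complement are \<^term>\<open>inf\<close>, \<^term>\<open>sup\<close> and \<^term>\<open>minus\<close>;
  in a lattice \<open>A \<le> B\<close> is equivalent to \<open>inf A B = A\<close>.
\<close>

class generalized_boolean_algebra = distrib_lattice + order_bot + minus +
  assumes inf_diff_self: "inf (x - y) y = bot"
    and sup_diff_inf: "sup (x - y) (inf x y) = x"

definition action :: "('b::generalized_boolean_algebra \<Rightarrow> 'b) \<Rightarrow> bool" where
  "action \<theta> \<longleftrightarrow>
     (\<forall>A B. \<theta> (inf A B) = inf (\<theta> A) (\<theta> B)) \<and>
     (\<forall>A B. \<theta> (sup A B) = sup (\<theta> A) (\<theta> B)) \<and>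
     (\<forall>A B. \<theta> (A - B) = \<theta> A - \<theta> B) \<and>
     \<theta> bot = bot"

definition compact_range :: "('b::generalized_boolean_algebra \<Rightarrow> 'b) \<Rightarrow> bool" where
  "compact_range \<theta> \<longleftrightarrow> (\<exists>R. isLub UNIV (range \<theta>) R)"

definition range_top :: "('b::generalized_boolean_algebra \<Rightarrow> 'b) \<Rightarrow> 'b" where
  "range_top \<theta> = (THE R. isLub UNIV (range \<theta>) R)"

definition closed_domain :: "('b::generalized_boolean_algebra \<Rightarrow> 'b) \<Rightarrow> bool" where
  "closed_domain \<theta> \<longleftrightarrow> (\<exists>D. \<theta> D = range_top \<theta>)"

text \<open>
  The label set \<open>L\<close> is a set rather than a type because it may be empty. For a word
  \<open>w = [\<alpha>\<^sub>1, \<dots>, \<alpha>\<^sub>n]\<close>, \<^term>\<open>fold \<theta> w\<close> is \<open>\<theta> \<alpha>\<^sub>n \<circ> \<dots> \<circ> \<theta> \<alpha>\<^sub>1\<close>.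
\<close>

definition boolean_dynamical_system ::
    "'l set \<Rightarrow> ('l \<Rightarrow> 'b::generalized_boolean_algebra \<Rightarrow> 'b) \<Rightarrow> bool" where
  "boolean_dynamical_system L \<theta> \<longleftrightarrow>
     (\<forall>\<alpha>\<in>L. action (\<theta> \<alpha>)) \<and>
     (\<forall>w\<in>lists L. w \<noteq> [] \<longrightarrow> compact_range (fold \<theta> w) \<and> closed_domain (fold \<theta> w))"

definition Delta ::
    "'l set \<Rightarrow> ('l \<Rightarrow> 'b::generalized_boolean_algebra \<Rightarrow> 'b) \<Rightarrow> 'b \<Rightarrow> 'l set" where
  "Delta L \<theta> B = {\<alpha>\<in>L. \<theta> \<alpha> B \<noteq> bot}"

definition regular_element ::
    "'l set \<Rightarrow> ('l \<Rightarrow> 'b::generalized_boolean_algebra \<Rightarrow> 'b) \<Rightarrow> 'b \<Rightarrow> bool" where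
  "regular_element L \<theta> A \<longleftrightarrow>
     (\<forall>B. B \<noteq> bot \<and> B \<le> A \<longrightarrow> finite (Delta L \<theta> B) \<and> 0 < card (Delta L \<theta> B))"

text \<open>
  A C*-algebra is a carrier set with operations. The algebraic part extends the module record of
  HOL-Algebra over the field of complex numbers. As C*-algebras need not be unital, the
  inherited field \<^const>\<open>one\<close> is neither constrained nor used.
\<close>

record 'a cstar = "(complex, 'a) module" +
  star :: "'a \<Rightarrow> 'a"
  cnorm :: "'a \<Rightarrow> real"

definition cstar_metric :: "'a cstar \<Rightarrow> 'a metric" where
  "cstar_metric A =
     metric (carrier A,
       \<lambda>x y. if x \<in> carrier A \<and> y \<in> carrier A then cnorm A (x \<ominus>\<^bsub>A\<^esub> y) else 0)"

locale cstar_algebra = module "ring_of_type_algebra :: complex ring" A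
  for A :: "'a cstar" (structure) +
  assumes mult_closed: "\<lbrakk>x \<in> carrier A; y \<in> carrier A\<rbrakk> \<Longrightarrow> x \<otimes> y \<in> carrier A"
    and mult_assoc: "\<lbrakk>x \<in> carrier A; y \<in> carrier A; z \<in> carrier A\<rbrakk> \<Longrightarrow>
      (x \<otimes> y) \<otimes> z = x \<otimes> (y \<otimes> z)"
    and mult_l_distr: "\<lbrakk>x \<in> carrier A; y \<in> carrier A; z \<in> carrier A\<rbrakk> \<Longrightarrow>
      (x \<oplus> y) \<otimes> z = x \<otimes> z \<oplus> y \<otimes> z"
    and mult_r_distr: "\<lbrakk>x \<in> carrier A; y \<in> carrier A; z \<in> carrier A\<rbrakk> \<Longrightarrow>
      z \<otimes> (x \<oplus> y) = z \<otimes> x \<oplus> z \<otimes> y"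
    and smult_mult_l: "\<lbrakk>x \<in> carrier A; y \<in> carrier A\<rbrakk> \<Longrightarrow> (c \<odot> x) \<otimes> y = c \<odot> (x \<otimes> y)"
    and smult_mult_r: "\<lbrakk>x \<in> carrier A; y \<in> carrier A\<rbrakk> \<Longrightarrow> x \<otimes> (c \<odot> y) = c \<odot> (x \<otimes> y)"
    and star_closed: "x \<in> carrier A \<Longrightarrow> star A x \<in> carrier A"
    and star_star: "x \<in> carrier A \<Longrightarrow> star A (star A x) = x"
    and star_add: "\<lbrakk>x \<in> carrier A; y \<in> carrier A\<rbrakk> \<Longrightarrow>
      star A (x \<oplus> y) = star A x \<oplus> star A y"
    and star_smult: "x \<in> carrier A \<Longrightarrow> star A (c \<odot> x) = cnj c \<odot> star A x"
    and star_mult: "\<lbrakk>x \<in> carrier A; y \<in> carrier A\<rbrakk> \<Longrightarrow>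
      star A (x \<otimes> y) = star A y \<otimes> star A x"
    and cnorm_nonneg: "x \<in> carrier A \<Longrightarrow> 0 \<le> cnorm A x"
    and cnorm_eq_zero: "x \<in> carrier A \<Longrightarrow> cnorm A x = 0 \<longleftrightarrow> x = \<zero>"
    and cnorm_triangle: "\<lbrakk>x \<in> carrier A; y \<in> carrier A\<rbrakk> \<Longrightarrow>
      cnorm A (x \<oplus> y) \<le> cnorm A x + cnorm A y"
    and cnorm_smult: "x \<in> carrier A \<Longrightarrow> cnorm A (c \<odot> x) = cmod c * cnorm A x"
    and cnorm_mult: "\<lbrakk>x \<in> carrier A; y \<in> carrier A\<rbrakk> \<Longrightarrow>
      cnorm A (x \<otimes> y) \<le> cnorm A x * cnorm A y"
    and cstar_identity: "x \<in> carrier A \<Longrightarrow> cnorm A (star A x \<otimes> x) = (cnorm A x)\<^sup>2"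
    and complete: "mcomplete_of (cstar_metric A)"

definition is_projection :: "'a cstar \<Rightarrow> 'a \<Rightarrow> bool" where
  "is_projection A x \<longleftrightarrow> x \<in> carrier A \<and> star A x = x \<and> x \<otimes>\<^bsub>A\<^esub> x = x"

definition is_partial_isometry :: "'a cstar \<Rightarrow> 'a \<Rightarrow> bool" where
  "is_partial_isometry A x \<longleftrightarrow> x \<in> carrier A \<and> x \<otimes>\<^bsub>A\<^esub> star A x \<otimes>\<^bsub>A\<^esub> x = x"

definition closed_subspace :: "'a cstar \<Rightarrow> 'a set \<Rightarrow> bool" where
  "closed_subspace A V \<longleftrightarrow>
     submodule V (ring_of_type_algebra :: complex ring) A \<and>
     closedin (mtopology_of (cstar_metric A)) V"

definition closed_span :: "'a cstar \<Rightarrow> 'a set \<Rightarrow> 'a set" where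
  "closed_span A W = closed_subspace A hull W"

definition cstar_subalgebra :: "'a cstar \<Rightarrow> 'a set \<Rightarrow> bool" where
  "cstar_subalgebra A V \<longleftrightarrow>
     closed_subspace A V \<and>
     (\<forall>x\<in>V. \<forall>y\<in>V. x \<otimes>\<^bsub>A\<^esub> y \<in> V) \<and>
     (\<forall>x\<in>V. star A x \<in> V)"

definition cstar_generated :: "'a cstar \<Rightarrow> 'a set \<Rightarrow> 'a cstar" where
  "cstar_generated A W = A\<lparr>carrier := cstar_subalgebra A hull W\<rparr>"

definition star_hom :: "'a cstar \<Rightarrow> 'c cstar \<Rightarrow> ('a \<Rightarrow> 'c) set" where
  "star_hom A B = {\<pi>. \<pi> \<in> carrier A \<rightarrow> carrier B \<and>
     (\<forall>x\<in>carrier A. \<forall>y\<in>carrier A. \<pi> (x \<oplus>\<^bsub>A\<^esub> y) = \<pi> x \<oplus>\<^bsub>B\<^esub> \<pi> y) \<and>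
     (\<forall>c. \<forall>x\<in>carrier A. \<pi> (c \<odot>\<^bsub>A\<^esub> x) = c \<odot>\<^bsub>B\<^esub> \<pi> x) \<and>
     (\<forall>x\<in>carrier A. \<forall>y\<in>carrier A. \<pi> (x \<otimes>\<^bsub>A\<^esub> y) = \<pi> x \<otimes>\<^bsub>B\<^esub> \<pi> y) \<and>
     (\<forall>x\<in>carrier A. \<pi> (star A x) = star B (\<pi> x))}"

definition star_iso :: "'a cstar \<Rightarrow> 'c cstar \<Rightarrow> ('a \<Rightarrow> 'c) set" where
  "star_iso A B = {\<pi> \<in> star_hom A B. bij_betw \<pi> (carrier A) (carrier B)}"

definition nondegenerate :: "'a cstar \<Rightarrow> 'c cstar \<Rightarrow> ('a \<Rightarrow> 'c) \<Rightarrow> bool" where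
  "nondegenerate A B \<pi> \<longleftrightarrow>
     closed_span B {\<pi> x \<otimes>\<^bsub>B\<^esub> y | x y. x \<in> carrier A \<and> y \<in> carrier B} = carrier B"

definition representation ::
    "'l set \<Rightarrow> ('l \<Rightarrow> 'b::generalized_boolean_algebra \<Rightarrow> 'b) \<Rightarrow>
     'a cstar \<Rightarrow> ('b \<Rightarrow> 'a) \<Rightarrow> ('l \<Rightarrow> 'a) \<Rightarrow> bool" where
  "representation L \<theta> \<A> P S \<longleftrightarrow>
     cstar_algebra \<A> \<and>
     (\<forall>A. is_projection \<A> (P A)) \<and>
     (\<forall>\<alpha>\<in>L. is_partial_isometry \<A> (S \<alpha>)) \<and>
     (\<forall>A B. P A \<otimes>\<^bsub>\<A>\<^esub> P B = P (inf A B)) \<and>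
     (\<forall>A B. P (sup A B) = P A \<oplus>\<^bsub>\<A>\<^esub> P B \<ominus>\<^bsub>\<A>\<^esub> P (inf A B)) \<and>
     P bot = \<zero>\<^bsub>\<A>\<^esub> \<and>
     (\<forall>\<alpha>\<in>L. \<forall>A. P A \<otimes>\<^bsub>\<A>\<^esub> S \<alpha> = S \<alpha> \<otimes>\<^bsub>\<A>\<^esub> P (\<theta> \<alpha> A)) \<and>
     (\<forall>\<alpha>\<in>L. \<forall>\<beta>\<in>L. star \<A> (S \<alpha>) \<otimes>\<^bsub>\<A>\<^esub> S \<beta> =
        (if \<alpha> = \<beta> then P (range_top (\<theta> \<alpha>)) else \<zero>\<^bsub>\<A>\<^esub>)) \<and>
     (\<forall>A. regular_element L \<theta> A \<longrightarrow>
        P A = finsum \<A> (\<lambda>\<alpha>. S \<alpha> \<otimes>\<^bsub>\<A>\<^esub> P (\<theta> \<alpha> A) \<otimes>\<^bsub>\<A>\<^esub> star \<A> (S \<alpha>)) (Delta L \<theta> A))"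

definition rep_algebra ::
    "'l set \<Rightarrow> 'a cstar \<Rightarrow> ('b \<Rightarrow> 'a) \<Rightarrow> ('l \<Rightarrow> 'a) \<Rightarrow> 'a cstar" where
  "rep_algebra L \<A> P S = cstar_generated \<A> (range P \<union> S ` L)"

text \<open>
  \<open>universal_representation TYPE('c) L \<theta> U p s\<close> is the universal property tested against the
  representations in all C*-algebras whose elements have type \<open>'c\<close>; one formula of HOL cannot
  quantify over all types.

  Non-degeneracy refers to the C*-subalgebra generated by the target representation: relative to
  the whole of \<open>\<A>\<close> it fails for the zero representation in any nonzero \<open>\<A>\<close>, so that no
  universal representation could exist.
\<close>

definition universal_representation ::
    "'c itself \<Rightarrow> 'l set \<Rightarrow> ('l \<Rightarrow> 'b::generalized_boolean_algebra \<Rightarrow> 'b) \<Rightarrow>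
     'u cstar \<Rightarrow> ('b \<Rightarrow> 'u) \<Rightarrow> ('l \<Rightarrow> 'u) \<Rightarrow> bool" where
  "universal_representation _ L \<theta> U p s \<longleftrightarrow>
     representation L \<theta> U p s \<and>
     (\<forall>(\<A> :: 'c cstar) P S. representation L \<theta> \<A> P S \<longrightarrow>
        (\<exists>\<pi> \<in> star_hom (rep_algebra L U p s) \<A>.
           nondegenerate (rep_algebra L U p s) (rep_algebra L \<A> P S) \<pi> \<and>
           (\<forall>A. \<pi> (p A) = P A) \<and> (\<forall>\<alpha>\<in>L. \<pi> (s \<alpha>) = S \<alpha>)))"

text \<open>
  Sequences of formal *-polynomials in the symbols \<open>p\<^sub>A\<close> (\<open>Inl A\<close>), \<open>s\<^sub>\<alpha>\<close> (\<open>Inr (Inl \<alpha>)\<close>) and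
  \<open>s\<^sub>\<alpha>\<^sup>*\<close> (\<open>Inr (Inr \<alpha>)\<close>). Every element of the C*-algebra generated by a representation is the
  limit of such a sequence, so that every such C*-algebra has an isomorphic copy whose elements
  have this type. Hence this type suffices for testing universality.
\<close>

type_synonym ('b, 'l) star_poly_seq = "nat \<Rightarrow> (complex \<times> ('b + 'l + 'l) list) list"

end

theory Submission
  imports Defs
begin

text \<open>
  The generators of a representation are projections and partial isometries, so their norms are at
  most 1 in every representation. Hence the direct sum of any set of representations is again a
  representation, in the bounded product of the target C*-algebras, and the coordinate
  projections map it to its summands. A direct sum over all representations is therefore universal.

  The difficulty is that representations on all types do not form a set. Formal polynomials in the
  generators and their adjoints are dense in the generated algebra, so each element can be
  coded by a sequence of polynomials (\<open>polynomials_dense\<close>). Every representation thus has a copy on one fixed type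
  (\<open>representation_copy\<close>); the direct sum over the representations on that type suffices, and it has a
  copy on the type as well (\<open>universal_representation_exists\<close>). The same copies carry universality from
  that type to any other (\<open>universal_representation_any_type\<close>).

  Uniqueness needs that a *-homomorphism is determined by its values on the generators, hence that
  *-homomorphisms are continuous (\<open>star_hom_contractive\<close>). The usual argument compares spectral radii. Here a
  self-adjoint \<open>x\<close> with \<open>\<parallel>x\<parallel> < 1\<close> is seen as the real part of the unitary
  \<open>x + i sqrt (1 - x\<^sup>2)\<close>; the square root is obtained by iterating a contraction, and the image of this
  description under a homomorphism shows that the image of \<open>x\<close> is a real part of a unitary too and so
  has norm at most 1.

  Nondegeneracy holds since a generator \<open>a\<close> is a partial isometry, \<open>a = a (a* a)\<close>, so that all
  words in the generators are products of an image with an element of the algebra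
  (\<open>rep_algebra_hom_nondegenerate\<close>).
\<close>

section \<open>Arithmetic and limits in C*-algebras\<close>

lemma ring_of_type_algebra_simps [simp]:
  "carrier (ring_of_type_algebra :: complex ring) = UNIV"
  "\<zero>\<^bsub>(ring_of_type_algebra :: complex ring)\<^esub> = 0"
  "\<one>\<^bsub>(ring_of_type_algebra :: complex ring)\<^esub> = 1"
  "x \<oplus>\<^bsub>(ring_of_type_algebra :: complex ring)\<^esub> y = x + y"
  "x \<otimes>\<^bsub>(ring_of_type_algebra :: complex ring)\<^esub> y = x * y"
  by (simp_all add: ring_of_type_algebra_def)

definition cstar_lim :: "'a cstar \<Rightarrow> (nat \<Rightarrow> 'a) \<Rightarrow> 'a \<Rightarrow> bool" where
  "cstar_lim A x l \<longleftrightarrow> range x \<subseteq> carrier A \<and> l \<in> carrier A \<and>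
     (\<lambda>n. cnorm A (x n \<ominus>\<^bsub>A\<^esub> l)) \<longlonglongrightarrow> 0"

context cstar_algebra
begin

lemmas closed [simp] = M.a_closed M.zero_closed M.a_inv_closed M.minus_closed mult_closed star_closed

lemma smult_in [simp]: "x \<in> carrier A \<Longrightarrow> c \<odot> x \<in> carrier A"
  by (rule smult_closed) simp_all

lemma smult_dist_l: "x \<in> carrier A \<Longrightarrow> (a + b) \<odot> x = a \<odot> x \<oplus> b \<odot> x"
  using smult_l_distr[of a b x] by simp

lemma smult_dist_r: "x \<in> carrier A \<Longrightarrow> y \<in> carrier A \<Longrightarrow> c \<odot> (x \<oplus> y) = c \<odot> x \<oplus> c \<odot> y"
  using smult_r_distr[of c x y] by simp

lemma smult_smult [simp]: "x \<in> carrier A \<Longrightarrow> a \<odot> (b \<odot> x) = (a * b) \<odot> x"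
  using smult_assoc1[of a b x] by simp

lemma smult_1 [simp]: "x \<in> carrier A \<Longrightarrow> 1 \<odot> x = x"
  using smult_one[of x] by simp

lemma smult_0 [simp]: "x \<in> carrier A \<Longrightarrow> 0 \<odot> x = \<zero>"
  using smult_l_null[of x] by simp

lemma neg_smult: "x \<in> carrier A \<Longrightarrow> \<ominus> x = (- 1) \<odot> x"
proof -
  assume x: "x \<in> carrier A"
  have "(- 1) \<odot> x \<oplus> x = (- 1 + 1) \<odot> x"
    using x by (subst smult_dist_l) simp_all
  then have "(- 1) \<odot> x \<oplus> x = \<zero>" using x by simp
  then show ?thesis using x M.minus_equality by simp
qed

lemma diff_smult: "x \<in> carrier A \<Longrightarrow> y \<in> carrier A \<Longrightarrow> x \<ominus> y = x \<oplus> (- 1) \<odot> y"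
  by (simp add: a_minus_def neg_smult)

lemma diff_self [simp]: "x \<in> carrier A \<Longrightarrow> x \<ominus> x = \<zero>"
  by (simp add: a_minus_def M.r_neg)

lemma diff_eq_zero: "x \<in> carrier A \<Longrightarrow> y \<in> carrier A \<Longrightarrow> x \<ominus> y = \<zero> \<longleftrightarrow> x = y"
  by (metis M.minus_equality M.minus_minus M.r_neg a_minus_def closed(3))

lemma mult_zero [simp]: "x \<in> carrier A \<Longrightarrow> \<zero> \<otimes> x = \<zero>" "x \<in> carrier A \<Longrightarrow> x \<otimes> \<zero> = \<zero>"
  using smult_mult_l[of \<zero> x 0] smult_mult_r[of x \<zero> 0] by simp_all

lemma star_zero [simp]: "star A \<zero> = \<zero>"
  using star_smult[of \<zero> 0] by simp

lemma star_diff: "x \<in> carrier A \<Longrightarrow> y \<in> carrier A \<Longrightarrow> star A (x \<ominus> y) = star A x \<ominus> star A y"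
  by (simp add: diff_smult star_add star_smult)

lemma smult_diff: "x \<in> carrier A \<Longrightarrow> y \<in> carrier A \<Longrightarrow> c \<odot> (x \<ominus> y) = c \<odot> x \<ominus> c \<odot> y"
  by (simp add: diff_smult smult_dist_r)

lemma mult_diff_l: "x \<in> carrier A \<Longrightarrow> y \<in> carrier A \<Longrightarrow> z \<in> carrier A \<Longrightarrow>
    (x \<ominus> y) \<otimes> z = x \<otimes> z \<ominus> y \<otimes> z"
  by (simp add: diff_smult mult_l_distr smult_mult_l)

lemma mult_diff_r: "x \<in> carrier A \<Longrightarrow> y \<in> carrier A \<Longrightarrow> z \<in> carrier A \<Longrightarrow>
    z \<otimes> (x \<ominus> y) = z \<otimes> x \<ominus> z \<otimes> y"
  by (simp add: diff_smult mult_r_distr smult_mult_r)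

lemma diff_add_diff: "x \<in> carrier A \<Longrightarrow> y \<in> carrier A \<Longrightarrow> z \<in> carrier A \<Longrightarrow>
    (x \<ominus> y) \<oplus> (y \<ominus> z) = x \<ominus> z"
  by (simp add: a_minus_def M.a_assoc) (simp add: M.a_assoc[symmetric] M.l_neg)

lemma add_diff_add: "x \<in> carrier A \<Longrightarrow> y \<in> carrier A \<Longrightarrow> x' \<in> carrier A \<Longrightarrow> y' \<in> carrier A \<Longrightarrow>
    (x \<oplus> y) \<ominus> (x' \<oplus> y') = (x \<ominus> x') \<oplus> (y \<ominus> y')"
  by (simp add: diff_smult smult_dist_r M.a_ac)

lemma cnorm_zero [simp]: "cnorm A \<zero> = 0"
  by (simp add: cnorm_eq_zero)

lemma cnorm_diff_commute: "x \<in> carrier A \<Longrightarrow> y \<in> carrier A \<Longrightarrow> cnorm A (x \<ominus> y) = cnorm A (y \<ominus> x)"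
proof -
  assume x: "x \<in> carrier A" and y: "y \<in> carrier A"
  have "y \<ominus> x = (- 1) \<odot> (x \<ominus> y)"
    using x y by (simp add: diff_smult smult_dist_r M.a_comm)
  then show ?thesis using x y by (simp add: cnorm_smult)
qed

lemma cnorm_diff_triangle: "x \<in> carrier A \<Longrightarrow> y \<in> carrier A \<Longrightarrow> z \<in> carrier A \<Longrightarrow>
    cnorm A (x \<ominus> z) \<le> cnorm A (x \<ominus> y) + cnorm A (y \<ominus> z)"
  using cnorm_triangle[of "x \<ominus> y" "y \<ominus> z"] diff_add_diff[of x y z] by simp

lemma cnorm_diff_le: "x \<in> carrier A \<Longrightarrow> y \<in> carrier A \<Longrightarrow> cnorm A x \<le> cnorm A (x \<ominus> y) + cnorm A y"
  using cnorm_diff_triangle[of x y \<zero>] by (simp add: diff_smult)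

lemma cnorm_star [simp]: "x \<in> carrier A \<Longrightarrow> cnorm A (star A x) = cnorm A x"
proof -
  have le: "cnorm A x \<le> cnorm A (star A x)" if x: "x \<in> carrier A" for x
  proof (cases "cnorm A x = 0")
    case True then show ?thesis using x by (simp add: cnorm_nonneg)
  next
    case False
    have "cnorm A x * cnorm A x \<le> cnorm A (star A x) * cnorm A x"
      using cnorm_mult[of "star A x" x] cstar_identity[of x] x by (simp add: power2_eq_square)
    then show ?thesis using False x cnorm_nonneg[of x] by simp
  qed
  assume "x \<in> carrier A"
  then show ?thesis using le[of x] le[of "star A x"] by (simp add: star_star)
qed

lemma cnorm_selfadjoint_square: "x \<in> carrier A \<Longrightarrow> star A x = x \<Longrightarrow> cnorm A (x \<otimes> x) = (cnorm A x)\<^sup>2"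
  using cstar_identity[of x] by simp

text \<open>
  If \<open>x x* x = x\<close>, then \<open>x* x\<close> is a projection, and the C*-identity leaves only 0 and 1 for the norm
  of a projection. This uniform bound is what makes the generators of all representations together
  a bounded family.
\<close>
lemma cnorm_partial_isometry: "is_partial_isometry A x \<Longrightarrow> cnorm A x \<le> 1"
proof -
  assume "is_partial_isometry A x"
  then have x: "x \<in> carrier A" and px: "x \<otimes> star A x \<otimes> x = x"
    by (auto simp: is_partial_isometry_def)
  let ?p = "star A x \<otimes> x"
  have "?p \<otimes> ?p = star A x \<otimes> (x \<otimes> star A x \<otimes> x)" using x by (simp add: mult_assoc)
  then have "?p \<otimes> ?p = ?p" using px by simp
  moreover have "star A ?p = ?p" using x by (simp add: star_mult star_star)
  ultimately have "cnorm A ?p = (cnorm A ?p)\<^sup>2"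
    using cnorm_selfadjoint_square[of ?p] x by simp
  then have "cnorm A ?p = 0 \<or> cnorm A ?p = 1" by (simp add: power2_eq_square)
  then have "(cnorm A x)\<^sup>2 \<le> 1" using cstar_identity[of x] x by auto
  then show ?thesis using abs_le_square_iff[of "cnorm A x" 1] by simp
qed

lemma projection_partial_isometry: "is_projection A x \<Longrightarrow> is_partial_isometry A x"
  by (simp add: is_projection_def is_partial_isometry_def)

abbreviation cdist :: "'a \<Rightarrow> 'a \<Rightarrow> real" where
  "cdist x y \<equiv> if x \<in> carrier A \<and> y \<in> carrier A then cnorm A (x \<ominus> y) else 0"

lemma metric_space: "Metric_space (carrier A) cdist"
proof
  fix x y z
  show "0 \<le> cdist x y" by (auto simp: cnorm_nonneg)
  show "cdist x y = cdist y x" using cnorm_diff_commute by auto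
  assume "x \<in> carrier A" "y \<in> carrier A"
  then show "cdist x y = 0 \<longleftrightarrow> x = y" by (simp add: cnorm_eq_zero diff_eq_zero)
  assume "z \<in> carrier A"
  with \<open>x \<in> carrier A\<close> \<open>y \<in> carrier A\<close> show "cdist x z \<le> cdist x y + cdist y z"
    using cnorm_diff_triangle by auto
qed

sublocale met: Metric_space "carrier A" cdist by (rule metric_space)

lemma cstar_metric_eq: "cstar_metric A = metric (carrier A, cdist)"
  by (simp add: cstar_metric_def)

lemma limitin_iff_cstar_lim:
  assumes "range x \<subseteq> carrier A"
  shows "limitin met.mtopology x l sequentially \<longleftrightarrow> cstar_lim A x l"
proof -
  have x: "x n \<in> carrier A" for n using assms by blast
  have "eventually (\<lambda>n. x n \<in> carrier A) sequentially" using x by simp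
  moreover have "(\<lambda>n. cdist (x n) l) = (\<lambda>n. cnorm A (x n \<ominus> l))" if "l \<in> carrier A"
    using that x by simp
  ultimately show ?thesis
    unfolding met.limitin_metric_dist_null cstar_lim_def using assms by force
qed

lemma closed_iff_limits:
  "closedin (mtopology_of (cstar_metric A)) V \<longleftrightarrow>
     V \<subseteq> carrier A \<and> (\<forall>x l. range x \<subseteq> V \<and> cstar_lim A x l \<longrightarrow> l \<in> V)"
proof -
  have "limitin met.mtopology x l sequentially \<longleftrightarrow> cstar_lim A x l"
    if "V \<subseteq> carrier A" "range x \<subseteq> V" for x l
    using limitin_iff_cstar_lim that by blast
  then show ?thesis
    unfolding cstar_metric_eq met.mtopology_of met.metric_closedin_iff_sequentially_closed
    by blast
qed

lemma Cauchy_convergent: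
  assumes "range x \<subseteq> carrier A" "\<And>e. e > 0 \<Longrightarrow> \<exists>N. \<forall>m\<ge>N. \<forall>n\<ge>N. cnorm A (x m \<ominus> x n) < e"
  obtains l where "cstar_lim A x l"
proof -
  have "met.MCauchy x"
    unfolding met.MCauchy_def using assms by (metis range_subsetD)
  moreover have "met.mcomplete" using complete by (simp add: cstar_metric_eq)
  ultimately obtain l where "limitin met.mtopology x l sequentially"
    unfolding met.mcomplete_def by blast
  then show ?thesis using that limitin_iff_cstar_lim assms by blast
qed

lemma lim_unique: "cstar_lim A x l \<Longrightarrow> cstar_lim A x l' \<Longrightarrow> l = l'"
  using met.limitin_metric_unique[of x l sequentially l'] limitin_iff_cstar_lim
  by (auto simp: cstar_lim_def)

lemma lim_const: "l \<in> carrier A \<Longrightarrow> cstar_lim A (\<lambda>_. l) l"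
  by (auto simp: cstar_lim_def)

lemma limI:
  assumes "range x \<subseteq> carrier A" "l \<in> carrier A" "\<And>n. cnorm A (x n \<ominus> l) \<le> f n" "f \<longlonglongrightarrow> 0"
  shows "cstar_lim A x l"
proof -
  have "x n \<in> carrier A" for n using assms(1) by blast
  then have "norm (cnorm A (x n \<ominus> l)) \<le> f n" for n
    using assms(2,3) by (simp add: cnorm_nonneg)
  then have "(\<lambda>n. cnorm A (x n \<ominus> l)) \<longlonglongrightarrow> 0"
    by (intro Lim_null_comparison[OF _ assms(4)]) simp
  then show ?thesis using assms(1,2) by (simp add: cstar_lim_def)
qed

lemma lim_add:
  assumes "cstar_lim A x l" "cstar_lim A y m"
  shows "cstar_lim A (\<lambda>n. x n \<oplus> y n) (l \<oplus> m)"
proof (rule limI)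
  have c: "x n \<in> carrier A" "y n \<in> carrier A" "l \<in> carrier A" "m \<in> carrier A" for n
    using assms by (auto simp: cstar_lim_def)
  show "range (\<lambda>n. x n \<oplus> y n) \<subseteq> carrier A" "l \<oplus> m \<in> carrier A" using c by auto
  show "cnorm A (x n \<oplus> y n \<ominus> (l \<oplus> m)) \<le> cnorm A (x n \<ominus> l) + cnorm A (y n \<ominus> m)" for n
    using c by (simp add: add_diff_add cnorm_triangle)
  show "(\<lambda>n. cnorm A (x n \<ominus> l) + cnorm A (y n \<ominus> m)) \<longlonglongrightarrow> 0"
    using assms unfolding cstar_lim_def by (intro tendsto_add_zero) simp_all
qed

lemma lim_smult:
  assumes "cstar_lim A x l"
  shows "cstar_lim A (\<lambda>n. c \<odot> x n) (c \<odot> l)"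
proof (rule limI)
  have c: "x n \<in> carrier A" "l \<in> carrier A" for n
    using assms by (auto simp: cstar_lim_def)
  show "range (\<lambda>n. c \<odot> x n) \<subseteq> carrier A" "c \<odot> l \<in> carrier A" using c by auto
  show "cnorm A (c \<odot> x n \<ominus> c \<odot> l) \<le> cmod c * cnorm A (x n \<ominus> l)" for n
    using c by (simp add: smult_diff[symmetric] cnorm_smult)
  show "(\<lambda>n. cmod c * cnorm A (x n \<ominus> l)) \<longlonglongrightarrow> 0"
    using assms unfolding cstar_lim_def by (intro tendsto_mult_right_zero) simp_all
qed

lemma lim_star:
  assumes "cstar_lim A x l"
  shows "cstar_lim A (\<lambda>n. star A (x n)) (star A l)"
proof -
  have c: "x n \<in> carrier A" "l \<in> carrier A" for n
    using assms by (auto simp: cstar_lim_def)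
  then show ?thesis
    using assms by (auto simp: cstar_lim_def star_diff[symmetric])
qed

lemma lim_norm:
  assumes "cstar_lim A x l"
  shows "(\<lambda>n. cnorm A (x n)) \<longlonglongrightarrow> cnorm A l"
proof -
  have c: "x n \<in> carrier A" "l \<in> carrier A" for n
    using assms by (auto simp: cstar_lim_def)
  have "\<bar>cnorm A (x n) - cnorm A l\<bar> \<le> cnorm A (x n \<ominus> l)" for n
    using cnorm_diff_le[of "x n" l] cnorm_diff_le[of l "x n"] cnorm_diff_commute[of l "x n"] c
    by simp
  then have "\<forall>n. norm (cnorm A (x n) - cnorm A l) \<le> cnorm A (x n \<ominus> l)" by simp
  then have "\<forall>\<^sub>F n in sequentially. norm (cnorm A (x n) - cnorm A l) \<le> cnorm A (x n \<ominus> l)"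
    by (rule always_eventually)
  moreover have "(\<lambda>n. cnorm A (x n \<ominus> l)) \<longlonglongrightarrow> 0"
    using assms by (simp add: cstar_lim_def)
  ultimately have "(\<lambda>n. cnorm A (x n) - cnorm A l) \<longlonglongrightarrow> 0"
    by (rule Lim_null_comparison)
  then show ?thesis by (rule LIM_zero_cancel)
qed

lemma lim_mult:
  assumes "cstar_lim A x l" "cstar_lim A y m"
  shows "cstar_lim A (\<lambda>n. x n \<otimes> y n) (l \<otimes> m)"
proof (rule limI)
  have c: "x n \<in> carrier A" "y n \<in> carrier A" "l \<in> carrier A" "m \<in> carrier A" for n
    using assms by (auto simp: cstar_lim_def)
  show "range (\<lambda>n. x n \<otimes> y n) \<subseteq> carrier A" "l \<otimes> m \<in> carrier A" using c by auto
  show "cnorm A (x n \<otimes> y n \<ominus> l \<otimes> m) \<le>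
      cnorm A (x n \<ominus> l) * cnorm A (y n) + cnorm A l * cnorm A (y n \<ominus> m)" (is "_ \<le> ?r n") for n
  proof -
    have "x n \<otimes> y n \<ominus> l \<otimes> m = (x n \<ominus> l) \<otimes> y n \<oplus> l \<otimes> (y n \<ominus> m)"
      using c by (simp add: mult_diff_l mult_diff_r diff_add_diff)
    also have "cnorm A \<dots> \<le> cnorm A ((x n \<ominus> l) \<otimes> y n) + cnorm A (l \<otimes> (y n \<ominus> m))"
      using c by (intro cnorm_triangle) auto
    also have "\<dots> \<le> ?r n" using c by (intro add_mono cnorm_mult) auto
    finally show ?thesis .
  qed
  have "?r \<longlonglongrightarrow> 0 * cnorm A m + cnorm A l * 0"
    using assms lim_norm[OF assms(2)] unfolding cstar_lim_def by (intro tendsto_intros) auto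
  then show "?r \<longlonglongrightarrow> 0" by simp
qed

end

section \<open>Closed subspaces and C*-subalgebras\<close>

context cstar_algebra
begin

lemma closed_subspace_iff:
  "closed_subspace A V \<longleftrightarrow> V \<subseteq> carrier A \<and> \<zero> \<in> V \<and> (\<forall>x\<in>V. \<forall>y\<in>V. x \<oplus> y \<in> V) \<and>
     (\<forall>c. \<forall>x\<in>V. c \<odot> x \<in> V) \<and> (\<forall>x l. range x \<subseteq> V \<and> cstar_lim A x l \<longrightarrow> l \<in> V)"
  (is "_ \<longleftrightarrow> ?r")
proof
  assume cl: "closed_subspace A V"
  then interpret submodule V "ring_of_type_algebra :: complex ring" A
    by (simp add: closed_subspace_def)
  have s: "c \<odot> x \<in> V" if "x \<in> V" for c x
    using smult_closed[of c x] that by simp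
  show ?r
    using cl closed_iff_limits s subset one_closed m_closed by (auto simp: closed_subspace_def)
next
  assume r: ?r
  have "submodule V (ring_of_type_algebra :: complex ring) A"
    using r by (intro submoduleI) (auto simp: neg_smult subset_iff)
  then show "closed_subspace A V" using r by (simp add: closed_subspace_def closed_iff_limits)
qed

lemma subalgebra_iff:
  "cstar_subalgebra A V \<longleftrightarrow> V \<subseteq> carrier A \<and> \<zero> \<in> V \<and> (\<forall>x\<in>V. \<forall>y\<in>V. x \<oplus> y \<in> V) \<and>
     (\<forall>c. \<forall>x\<in>V. c \<odot> x \<in> V) \<and> (\<forall>x\<in>V. \<forall>y\<in>V. x \<otimes> y \<in> V) \<and> (\<forall>x\<in>V. star A x \<in> V) \<and>
     (\<forall>x l. range x \<subseteq> V \<and> cstar_lim A x l \<longrightarrow> l \<in> V)"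
  unfolding cstar_subalgebra_def closed_subspace_iff by blast

lemma subalgebra_carrier: "cstar_subalgebra A (carrier A)"
  unfolding subalgebra_iff by (auto simp: cstar_lim_def)

lemma subalgebra_hull:
  assumes "W \<subseteq> carrier A"
  shows "cstar_subalgebra A (cstar_subalgebra A hull W)"
proof (subst subalgebra_iff, intro conjI ballI allI impI)
  show "cstar_subalgebra A hull W \<subseteq> carrier A"
    using assms subalgebra_carrier by (rule hull_minimal)
  fix x l assume x: "range x \<subseteq> cstar_subalgebra A hull W \<and> cstar_lim A x l"
  have "l \<in> t" if t: "cstar_subalgebra A t" "W \<subseteq> t" for t
  proof -
    have "range x \<subseteq> t" using x hull_minimal[of W t "cstar_subalgebra A", OF t(2,1)] by (auto simp: closed_span_def)
    then show ?thesis using x t(1) by (auto simp: subalgebra_iff)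
  qed
  then show "l \<in> cstar_subalgebra A hull W" by (auto simp: hull_def closed_span_def)
qed (auto simp: hull_def subalgebra_iff)

lemma closed_subspace_hull:
  assumes "W \<subseteq> carrier A"
  shows "closed_subspace A (closed_span A W)"
proof (subst closed_subspace_iff, intro conjI ballI allI impI)
  have "closed_subspace A (carrier A)"
    using subalgebra_carrier by (simp add: cstar_subalgebra_def)
  with assms show "closed_span A W \<subseteq> carrier A"
    unfolding closed_span_def by (rule hull_minimal)
  fix x l assume x: "range x \<subseteq> closed_span A W \<and> cstar_lim A x l"
  have "l \<in> t" if t: "closed_subspace A t" "W \<subseteq> t" for t
  proof -
    have "range x \<subseteq> t" using x hull_minimal[of W t "closed_subspace A", OF t(2,1)] by (auto simp: closed_span_def)
    then show ?thesis using x t(1) by (auto simp: closed_subspace_iff)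
  qed
  then show "l \<in> closed_span A W" by (auto simp: hull_def closed_span_def)
qed (auto simp: hull_def closed_span_def closed_subspace_iff)

text \<open>
  The closure of a *-subalgebra is the set of limits of its sequences; the algebraic operations
  are sequentially continuous.
\<close>
lemma subalgebra_closure:
  assumes W: "W \<subseteq> carrier A" "\<zero> \<in> W"
    and ops: "\<And>x y. x \<in> W \<Longrightarrow> y \<in> W \<Longrightarrow> x \<oplus> y \<in> W" "\<And>c x. x \<in> W \<Longrightarrow> c \<odot> x \<in> W"
      "\<And>x y. x \<in> W \<Longrightarrow> y \<in> W \<Longrightarrow> x \<otimes> y \<in> W" "\<And>x. x \<in> W \<Longrightarrow> star A x \<in> W"
  shows "cstar_subalgebra A {l. \<exists>x. range x \<subseteq> W \<and> cstar_lim A x l}" (is "cstar_subalgebra A ?V")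
proof -
  have V: "?V = met.mtopology closure_of W"
    unfolding met.closure_of_sequentially
    using W(1) limitin_iff_cstar_lim by (auto simp: cstar_lim_def)
  have clos: "\<And>x l. range x \<subseteq> ?V \<Longrightarrow> cstar_lim A x l \<Longrightarrow> l \<in> ?V"
    using closedin_closure_of[of met.mtopology W] closed_iff_limits[of ?V]
    unfolding V cstar_metric_eq met.mtopology_of by blast
  show ?thesis
  proof (subst subalgebra_iff, intro conjI ballI allI impI)
    show "?V \<subseteq> carrier A" by (auto simp: cstar_lim_def)
    show "\<zero> \<in> ?V" using W lim_const[of \<zero>] by (auto intro!: exI[of _ "\<lambda>_. \<zero>"])
  next
    fix l m assume "l \<in> ?V" "m \<in> ?V"
    then obtain x y where xy: "range x \<subseteq> W" "cstar_lim A x l" "range y \<subseteq> W" "cstar_lim A y m"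
      by blast
    then have "range (\<lambda>n. x n \<oplus> y n) \<subseteq> W" "range (\<lambda>n. x n \<otimes> y n) \<subseteq> W"
      using ops by (auto simp: image_subset_iff)
    then show "l \<oplus> m \<in> ?V" "l \<otimes> m \<in> ?V"
      using lim_add[OF xy(2,4)] lim_mult[OF xy(2,4)] by (metis (mono_tags, lifting) mem_Collect_eq)+
  next
    fix c l assume "l \<in> ?V"
    then obtain x where x: "range x \<subseteq> W" "cstar_lim A x l" by blast
    then have "range (\<lambda>n. c \<odot> x n) \<subseteq> W" "range (\<lambda>n. star A (x n)) \<subseteq> W"
      using ops by (auto simp: image_subset_iff)
    then show "c \<odot> l \<in> ?V" "star A l \<in> ?V"
      using lim_smult[OF x(2)] lim_star[OF x(2)] by (metis (mono_tags, lifting) mem_Collect_eq)+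
  next
    fix x l assume "range x \<subseteq> ?V \<and> cstar_lim A x l"
    then show "l \<in> ?V" using clos by blast
  qed
qed

end

section \<open>Contractivity of *-homomorphisms\<close>

lemma star_homD:
  assumes "\<phi> \<in> star_hom A B"
  shows "x \<in> carrier A \<Longrightarrow> \<phi> x \<in> carrier B"
    and "x \<in> carrier A \<Longrightarrow> y \<in> carrier A \<Longrightarrow> \<phi> (x \<oplus>\<^bsub>A\<^esub> y) = \<phi> x \<oplus>\<^bsub>B\<^esub> \<phi> y"
    and "x \<in> carrier A \<Longrightarrow> \<phi> (c \<odot>\<^bsub>A\<^esub> x) = c \<odot>\<^bsub>B\<^esub> \<phi> x"
    and "x \<in> carrier A \<Longrightarrow> y \<in> carrier A \<Longrightarrow> \<phi> (x \<otimes>\<^bsub>A\<^esub> y) = \<phi> x \<otimes>\<^bsub>B\<^esub> \<phi> y"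
    and "x \<in> carrier A \<Longrightarrow> \<phi> (star A x) = star B (\<phi> x)"
  using assms by (auto simp: star_hom_def)

lemma star_hom_comp:
  assumes "\<phi> \<in> star_hom A B" "\<psi> \<in> star_hom B C"
  shows "\<psi> \<circ> \<phi> \<in> star_hom A C"
  using assms by (auto simp: star_hom_def Pi_iff)

text \<open>
  The element \<open>v = 1 - sqrt (1 - x\<^sup>2)\<close>, described without a unit by \<open>2 v = x\<^sup>2 + v\<^sup>2\<close>. It is the limit
  of iterating \<open>v \<mapsto> (x\<^sup>2 + v\<^sup>2) / 2\<close> from 0: this map sends the ball of radius
  \<open>s = \<parallel>x\<parallel>\<^sup>2 < 1\<close> to itself and contracts it by the factor \<open>s\<close>. All iterates are self-adjoint and
  commute with \<open>x\<close>, and both properties pass to the limit.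
\<close>
lemma (in cstar_algebra) one_minus_sqrt_exists:
  assumes x: "x \<in> carrier A" "star A x = x" "cnorm A x < 1"
  obtains v where "v \<in> carrier A" "star A v = v" "x \<otimes> v = v \<otimes> x" "v \<oplus> v = x \<otimes> x \<oplus> v \<otimes> v"
proof -
  define s where "s = (cnorm A x)\<^sup>2"
  have s0: "0 \<le> s" by (simp add: s_def)
  have s1: "s < 1" using x cnorm_nonneg[of x] by (simp add: s_def abs_square_less_1)
  have nxx: "cnorm A (x \<otimes> x) = s" using x by (simp add: s_def cnorm_selfadjoint_square)
  define f where "f v = (1/2) \<odot> (x \<otimes> x \<oplus> v \<otimes> v)" for v
  define v where "v n = (f ^^ n) \<zero>" for n
  have vS: "v (Suc n) = f (v n)" for n by (simp add: v_def)
  have v: "v n \<in> carrier A \<and> star A (v n) = v n \<and> x \<otimes> v n = v n \<otimes> x \<and> cnorm A (v n) \<le> s" for n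
  proof (induction n)
    case 0
    show ?case using x s0 by (simp add: v_def)
  next
    case (Suc n)
    let ?v = "v n"
    have c: "?v \<in> carrier A" "star A ?v = ?v" "x \<otimes> ?v = ?v \<otimes> x" "cnorm A ?v \<le> s"
      using Suc by auto
    have "x \<otimes> (?v \<otimes> ?v) = (?v \<otimes> ?v) \<otimes> x"
      using c x by (metis mult_assoc)
    then have comm: "x \<otimes> f ?v = f ?v \<otimes> x"
      using c x by (simp add: f_def smult_mult_l smult_mult_r mult_l_distr mult_r_distr mult_assoc)
    have sa: "star A (f ?v) = f ?v"
      using c x by (simp add: f_def star_smult star_add star_mult)
    have "cnorm A (f ?v) \<le> (1/2) * (s + cnorm A ?v * cnorm A ?v)"
      using c x cnorm_triangle[of "x \<otimes> x" "?v \<otimes> ?v"] cnorm_mult[of ?v ?v]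
      by (simp add: f_def cnorm_smult nxx norm_divide)
    also have "cnorm A ?v * cnorm A ?v \<le> s * 1"
      using c cnorm_nonneg[of ?v] s1 by (intro mult_mono) auto
    finally have "cnorm A (f ?v) \<le> s" by simp
    with comm sa c x show ?case by (simp add: vS f_def)
  qed
  have step: "cnorm A (f a \<ominus> f b) \<le> s * cnorm A (a \<ominus> b)"
    if "a \<in> carrier A" "cnorm A a \<le> s" "b \<in> carrier A" "cnorm A b \<le> s" for a b
  proof -
    have "f a \<ominus> f b = (1/2) \<odot> (a \<otimes> a \<ominus> b \<otimes> b)"
      using that x
      by (simp add: f_def smult_diff[symmetric] add_diff_add)
    also have "a \<otimes> a \<ominus> b \<otimes> b = a \<otimes> (a \<ominus> b) \<oplus> (a \<ominus> b) \<otimes> b"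
      using that by (simp add: mult_diff_l mult_diff_r diff_add_diff)
    also have "cnorm A ((1/2) \<odot> (a \<otimes> (a \<ominus> b) \<oplus> (a \<ominus> b) \<otimes> b)) \<le>
        (1/2) * (cnorm A a * cnorm A (a \<ominus> b) + cnorm A (a \<ominus> b) * cnorm A b)"
      using that cnorm_triangle[of "a \<otimes> (a \<ominus> b)" "(a \<ominus> b) \<otimes> b"]
        cnorm_mult[of a "a \<ominus> b"] cnorm_mult[of "a \<ominus> b" b]
      by (simp add: cnorm_smult norm_divide)
    also have "\<dots> \<le> (1/2) * (s * cnorm A (a \<ominus> b) + cnorm A (a \<ominus> b) * s)"
      using that by (intro mult_left_mono add_mono mult_right_mono) (auto simp: cnorm_nonneg)
    finally show ?thesis by (simp add: mult.commute)
  qed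
  \<comment> \<open>Comparing an iterate with an arbitrary later one avoids geometric sums.\<close>
  have shift: "cnorm A (v (n + k) \<ominus> v n) \<le> s ^ n" for n k
  proof (induction n)
    case 0
    have "v k \<ominus> v 0 = v k" using v[of k] by (simp add: v_def diff_smult)
    then show ?case using v[of k] s1 by simp
  next
    case (Suc n)
    have "cnorm A (v (Suc n + k) \<ominus> v (Suc n)) \<le> s * cnorm A (v (n + k) \<ominus> v n)"
      using step[of "v (n + k)" "v n"] v by (simp add: vS)
    also have "\<dots> \<le> s * s ^ n" using Suc s0 by (intro mult_left_mono)
    finally show ?case by simp
  qed
  have r: "range v \<subseteq> carrier A" using v by blast
  have "\<exists>N. \<forall>m\<ge>N. \<forall>n\<ge>N. cnorm A (v m \<ominus> v n) < e" if "e > 0" for e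
  proof -
    have "(\<lambda>n. s ^ n) \<longlonglongrightarrow> 0" using s0 s1 by (intro LIMSEQ_realpow_zero)
    then have "\<forall>\<^sub>F n in sequentially. s ^ n < e / 2"
      using that by (intro order_tendstoD(2)) auto
    then obtain N where N: "s ^ N < e / 2" by (auto simp: eventually_sequentially)
    have "cnorm A (v m \<ominus> v N) < e / 2" if "m \<ge> N" for m
      using shift[of N "m - N"] N that by simp
    then have "cnorm A (v m \<ominus> v n) < e" if "m \<ge> N" "n \<ge> N" for m n
      using cnorm_diff_triangle[of "v m" "v N" "v n"] cnorm_diff_commute[of "v n" "v N"] v that
      by (smt (verit, best) field_sum_of_halves)
    then show ?thesis by blast
  qed
  then obtain w where w: "cstar_lim A v w" using Cauchy_convergent[OF r] by blast
  then have wc: "w \<in> carrier A" by (simp add: cstar_lim_def)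
  have "star A w = w" using lim_star[OF w] v w lim_unique by simp
  moreover have "x \<otimes> w = w \<otimes> x"
    using lim_mult[OF lim_const[OF x(1)] w] lim_mult[OF w lim_const[OF x(1)]] v lim_unique by simp
  moreover have "w = f w"
  proof (rule lim_unique)
    have "cstar_lim A (\<lambda>n. f (v n)) (f w)"
      unfolding f_def using x by (intro lim_smult lim_add lim_const lim_mult w) auto
    then show "cstar_lim A (\<lambda>n. v (Suc n)) (f w)" by (simp add: vS)
    show "cstar_lim A (\<lambda>n. v (Suc n)) w"
      using w v LIMSEQ_Suc[of "\<lambda>n. cnorm A (v n \<ominus> w)" 0] by (auto simp: cstar_lim_def)
  qed
  then have "2 \<odot> w = 2 \<odot> f w" by simp
  then have "w \<oplus> w = x \<otimes> x \<oplus> w \<otimes> w"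
    using x wc smult_dist_l[of w 1 1] by (simp add: f_def)
  ultimately show thesis using that wc by blast
qed

locale cstar_pair = A: cstar_algebra A + B: cstar_algebra B
  for A :: "'a cstar" and B :: "'c cstar"
begin

lemma hom_zero [simp]: "\<phi> \<in> star_hom A B \<Longrightarrow> \<phi> \<zero>\<^bsub>A\<^esub> = \<zero>\<^bsub>B\<^esub>"
  using star_homD(3)[of \<phi> A B "\<zero>\<^bsub>A\<^esub>" 0] star_homD(1)[of \<phi> A B "\<zero>\<^bsub>A\<^esub>"] by simp

lemma hom_diff:
  "\<phi> \<in> star_hom A B \<Longrightarrow> x \<in> carrier A \<Longrightarrow> y \<in> carrier A \<Longrightarrow> \<phi> (x \<ominus>\<^bsub>A\<^esub> y) = \<phi> x \<ominus>\<^bsub>B\<^esub> \<phi> y"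
  by (simp add: A.diff_smult B.diff_smult star_homD)

text \<open>
  If \<open>y\<close> is self-adjoint and \<open>1 - y\<^sup>2\<close> has a self-adjoint square root that commutes with \<open>y\<close>,
  then \<open>y + i sqrt (1 - y\<^sup>2)\<close> is unitary with real part \<open>y\<close>, so \<open>\<parallel>y\<parallel> \<le> 1\<close>.
  Here \<open>y = \<phi> x\<close>, and the square root exists because \<open>\<phi>\<close> maps \<open>1 - sqrt (1 - x\<^sup>2)\<close> to an
  element \<open>w\<close> that plays the same role for \<open>y\<close>. As there may be no unit, the two unitaries
  \<open>y \<plusminus> i (1 - w)\<close> are applied to \<open>y\<close>: the results have the norm of \<open>y\<close> and the sum
  \<open>2 y\<^sup>2\<close>. Hence \<open>\<parallel>y\<parallel>\<^sup>2 = \<parallel>y\<^sup>2\<parallel> \<le> \<parallel>y\<parallel>\<close>.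
\<close>
lemma selfadjoint_contractive:
  assumes \<phi>: "\<phi> \<in> star_hom A B" and x: "x \<in> carrier A" "star A x = x" "cnorm A x < 1"
  shows "cnorm B (\<phi> x) \<le> 1"
proof -
  obtain v where v: "v \<in> carrier A" "star A v = v" "x \<otimes>\<^bsub>A\<^esub> v = v \<otimes>\<^bsub>A\<^esub> x"
    "v \<oplus>\<^bsub>A\<^esub> v = x \<otimes>\<^bsub>A\<^esub> x \<oplus>\<^bsub>A\<^esub> v \<otimes>\<^bsub>A\<^esub> v"
    using A.one_minus_sqrt_exists[OF x] by blast
  define y where "y = \<phi> x"
  define w where "w = \<phi> v"
  note h = star_homD[OF \<phi>]
  have y: "y \<in> carrier B" "star B y = y" using h(1,5)[of x] x by (auto simp: y_def)
  have w: "w \<in> carrier B" "star B w = w" using h(1,5)[of v] v by (auto simp: w_def)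
  have comm: "y \<otimes>\<^bsub>B\<^esub> w = w \<otimes>\<^bsub>B\<^esub> y"
    using h(4)[of x v] h(4)[of v x] x v by (simp add: y_def w_def)
  have ww: "w \<oplus>\<^bsub>B\<^esub> w = y \<otimes>\<^bsub>B\<^esub> y \<oplus>\<^bsub>B\<^esub> w \<otimes>\<^bsub>B\<^esub> w"
    using arg_cong[OF v(4), of \<phi>] x(1) v(1) by (simp add: y_def w_def h)
  define a where "a = y \<otimes>\<^bsub>B\<^esub> y"
  define b where "b = y \<ominus>\<^bsub>B\<^esub> w \<otimes>\<^bsub>B\<^esub> y"
  \<comment> \<open>For \<open>c = \<plusminus> i\<close> this is the unitary \<open>y + c (1 - w)\<close> applied to \<open>y\<close>.\<close>
  define u where "u c = a \<oplus>\<^bsub>B\<^esub> c \<odot>\<^bsub>B\<^esub> b" for c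
  have aB: "a \<in> carrier B" "b \<in> carrier B" using y w by (simp_all add: a_def b_def)
  have uB: "u c \<in> carrier B" for c using aB by (simp add: u_def)
  have sa: "star B a = a" "star B b = b"
    using y w comm by (simp_all add: a_def b_def B.star_mult B.star_diff)
  have lcomm: "y \<otimes>\<^bsub>B\<^esub> (w \<otimes>\<^bsub>B\<^esub> z) = w \<otimes>\<^bsub>B\<^esub> (y \<otimes>\<^bsub>B\<^esub> z)" if "z \<in> carrier B" for z
    using y w that comm by (metis B.mult_assoc)
  have ab: "a \<otimes>\<^bsub>B\<^esub> b = b \<otimes>\<^bsub>B\<^esub> a"
    using y w by (simp add: a_def b_def B.mult_diff_l B.mult_diff_r B.mult_assoc lcomm)
  let ?wa = "w \<otimes>\<^bsub>B\<^esub> a" and ?wwa = "w \<otimes>\<^bsub>B\<^esub> (w \<otimes>\<^bsub>B\<^esub> a)"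
  have bb: "b \<otimes>\<^bsub>B\<^esub> b = (a \<ominus>\<^bsub>B\<^esub> ?wa) \<ominus>\<^bsub>B\<^esub> (?wa \<ominus>\<^bsub>B\<^esub> ?wwa)"
    using y w by (simp add: a_def b_def B.mult_diff_l B.mult_diff_r B.mult_assoc lcomm)
  have "?wa \<oplus>\<^bsub>B\<^esub> ?wa = a \<otimes>\<^bsub>B\<^esub> a \<oplus>\<^bsub>B\<^esub> ?wwa"
    using arg_cong[OF ww, of "\<lambda>t. t \<otimes>\<^bsub>B\<^esub> a"] y w aB
    by (simp add: B.mult_l_distr a_def[symmetric] B.mult_assoc)
  then have "a \<otimes>\<^bsub>B\<^esub> a \<oplus>\<^bsub>B\<^esub> ?wwa \<ominus>\<^bsub>B\<^esub> (?wa \<oplus>\<^bsub>B\<^esub> ?wa) = \<zero>\<^bsub>B\<^esub>"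
    using w aB by simp
  then have "a \<oplus>\<^bsub>B\<^esub> (a \<otimes>\<^bsub>B\<^esub> a \<oplus>\<^bsub>B\<^esub> ?wwa \<ominus>\<^bsub>B\<^esub> (?wa \<oplus>\<^bsub>B\<^esub> ?wa)) = a"
    using aB by simp
  \<comment> \<open>Multiplied out, this is \<open>(y\<^sup>2 + (1 - w)\<^sup>2) y\<^sup>2 = y\<^sup>2\<close>.\<close>
  then have aabb: "a \<otimes>\<^bsub>B\<^esub> a \<oplus>\<^bsub>B\<^esub> b \<otimes>\<^bsub>B\<^esub> b = a"
    using w aB by (simp add: bb B.diff_smult B.smult_dist_r B.M.a_ac)
  have iso: "star B (u c) \<otimes>\<^bsub>B\<^esub> u c = a" if c: "cnj c = - c" "c * c = - 1" for c
  proof -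
    have "star B (u c) \<otimes>\<^bsub>B\<^esub> u c =
        (a \<otimes>\<^bsub>B\<^esub> a \<oplus>\<^bsub>B\<^esub> b \<otimes>\<^bsub>B\<^esub> b) \<oplus>\<^bsub>B\<^esub> (c \<odot>\<^bsub>B\<^esub> (a \<otimes>\<^bsub>B\<^esub> b) \<oplus>\<^bsub>B\<^esub> (- c) \<odot>\<^bsub>B\<^esub> (a \<otimes>\<^bsub>B\<^esub> b))"
      using aB c sa
      by (simp add: u_def B.star_add B.star_smult B.mult_l_distr B.mult_r_distr
          B.smult_mult_l B.smult_mult_r B.smult_dist_r ab B.M.a_ac)
    also have "c \<odot>\<^bsub>B\<^esub> (a \<otimes>\<^bsub>B\<^esub> b) \<oplus>\<^bsub>B\<^esub> (- c) \<odot>\<^bsub>B\<^esub> (a \<otimes>\<^bsub>B\<^esub> b) = \<zero>\<^bsub>B\<^esub>"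
      using aB by (simp add: B.smult_dist_l[symmetric])
    finally show ?thesis using aB by (simp add: aabb)
  qed
  have nu: "cnorm B (u c) = cnorm B y" if c: "cnj c = - c" "c * c = - 1" for c
  proof -
    have "(cnorm B (u c))\<^sup>2 = (cnorm B y)\<^sup>2"
      using B.cstar_identity[OF uB[of c]] iso[OF c] B.cnorm_selfadjoint_square[OF y] by (simp add: a_def)
    then show ?thesis using B.cnorm_nonneg uB y by (simp add: power2_eq_iff_nonneg)
  qed
  have "u \<i> \<oplus>\<^bsub>B\<^esub> u (- \<i>) = (a \<oplus>\<^bsub>B\<^esub> a) \<oplus>\<^bsub>B\<^esub> (\<i> \<odot>\<^bsub>B\<^esub> b \<oplus>\<^bsub>B\<^esub> (- \<i>) \<odot>\<^bsub>B\<^esub> b)"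
    using aB by (simp add: u_def B.M.a_ac)
  also have "\<dots> = (1 + 1) \<odot>\<^bsub>B\<^esub> a \<oplus>\<^bsub>B\<^esub> (\<i> + (- \<i>)) \<odot>\<^bsub>B\<^esub> b"
    using aB B.smult_dist_l[of a 1 1] by (simp only: B.smult_dist_l B.smult_1)
  finally have "u \<i> \<oplus>\<^bsub>B\<^esub> u (- \<i>) = 2 \<odot>\<^bsub>B\<^esub> a"
    using aB by simp
  then have "2 * cnorm B a = cnorm B (u \<i> \<oplus>\<^bsub>B\<^esub> u (- \<i>))"
    using aB by (simp add: B.cnorm_smult)
  also have "\<dots> \<le> 2 * cnorm B y"
    using B.cnorm_triangle[OF uB uB, of \<i> "- \<i>"] nu[of \<i>] nu[of "- \<i>"] by simp
  finally have "cnorm B y * cnorm B y \<le> 1 * cnorm B y"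
    using B.cnorm_selfadjoint_square[OF y] by (simp add: a_def power2_eq_square)
  then show ?thesis
    unfolding y_def[symmetric] using B.cnorm_nonneg[OF y(1)]
    by (cases "cnorm B y = 0") (auto simp: mult_le_cancel_right)
qed

text \<open>
  Rescaling gives the bound for self-adjoint elements, and the C*-identity reduces an arbitrary \<open>x\<close> to
  the self-adjoint \<open>x* x\<close>. In particular every *-homomorphism is continuous, although continuity is
  no part of its definition.
\<close>
theorem star_hom_contractive:
  assumes \<phi>: "\<phi> \<in> star_hom A B" and x: "x \<in> carrier A"
  shows "cnorm B (\<phi> x) \<le> cnorm A x"
proof -
  note h = star_homD[OF \<phi>]
  have sa: "cnorm B (\<phi> z) \<le> cnorm A z" if z: "z \<in> carrier A" "star A z = z" for z
  proof (rule field_le_epsilon)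
    fix e :: real assume e: "0 < e"
    let ?r = "cnorm A z + e"
    have r: "?r > 0" using e A.cnorm_nonneg[OF z(1)] by simp
    let ?z = "complex_of_real (1 / ?r) \<odot>\<^bsub>A\<^esub> z"
    have "cnorm A ?z < 1" using z r e by (simp add: A.cnorm_smult norm_divide del: of_real_add)
    moreover have "star A ?z = ?z" using z by (simp add: A.star_smult)
    ultimately have "cnorm B (\<phi> ?z) \<le> 1" using z by (intro selfadjoint_contractive[OF \<phi>]) auto
    then show "cnorm B (\<phi> z) \<le> ?r"
      using z r h(1)[OF z(1)] by (simp add: h B.cnorm_smult norm_divide field_simps del: of_real_add)
  qed
  have "(cnorm B (\<phi> x))\<^sup>2 \<le> (cnorm A x)\<^sup>2"
    using sa[of "star A x \<otimes>\<^bsub>A\<^esub> x"] x h B.cstar_identity[of "\<phi> x"] A.cstar_identity[of x]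
    by (simp add: A.star_mult A.star_star)
  then show ?thesis using A.cnorm_nonneg[OF x] by (rule power2_le_imp_le)
qed

lemma hom_lim:
  assumes \<phi>: "\<phi> \<in> star_hom A B" and x: "cstar_lim A x l"
  shows "cstar_lim B (\<lambda>n. \<phi> (x n)) (\<phi> l)"
proof -
  have c: "x n \<in> carrier A" "l \<in> carrier A" for n using x by (auto simp: cstar_lim_def)
  show ?thesis
  proof (rule B.limI)
    show "range (\<lambda>n. \<phi> (x n)) \<subseteq> carrier B" "\<phi> l \<in> carrier B" using c star_homD(1)[OF \<phi>] by auto
    show "cnorm B (\<phi> (x n) \<ominus>\<^bsub>B\<^esub> \<phi> l) \<le> cnorm A (x n \<ominus>\<^bsub>A\<^esub> l)" for n
      using c star_hom_contractive[OF \<phi>, of "x n \<ominus>\<^bsub>A\<^esub> l"] by (simp add: hom_diff[OF \<phi>])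
    show "(\<lambda>n. cnorm A (x n \<ominus>\<^bsub>A\<^esub> l)) \<longlonglongrightarrow> 0" using x by (simp add: cstar_lim_def)
  qed
qed

lemma hom_preimage_subalgebra:
  assumes \<phi>: "\<phi> \<in> star_hom A B" and V: "cstar_subalgebra B V"
  shows "cstar_subalgebra A {x \<in> carrier A. \<phi> x \<in> V}"
proof (subst A.subalgebra_iff, intro conjI allI impI)
  fix x l assume "range x \<subseteq> {x \<in> carrier A. \<phi> x \<in> V} \<and> cstar_lim A x l"
  moreover from this have "cstar_lim B (\<lambda>n. \<phi> (x n)) (\<phi> l)" using hom_lim[OF \<phi>] by blast
  ultimately show "l \<in> {x \<in> carrier A. \<phi> x \<in> V}"
    using V by (auto simp: B.subalgebra_iff image_subset_iff cstar_lim_def)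
qed (use V star_homD[OF \<phi>] hom_zero[OF \<phi>] in \<open>auto simp: B.subalgebra_iff\<close>)

lemma hom_equalizer_subalgebra:
  assumes \<phi>: "\<phi> \<in> star_hom A B" and \<psi>: "\<psi> \<in> star_hom A B"
  shows "cstar_subalgebra A {x \<in> carrier A. \<phi> x = \<psi> x}"
proof (subst A.subalgebra_iff, intro conjI allI impI)
  fix x l assume "range x \<subseteq> {x \<in> carrier A. \<phi> x = \<psi> x} \<and> cstar_lim A x l"
  then show "l \<in> {x \<in> carrier A. \<phi> x = \<psi> x}"
    using hom_lim[OF \<phi>, of x l] hom_lim[OF \<psi>, of x l] B.lim_unique
    by (auto simp: image_subset_iff cstar_lim_def)
qed (use star_homD[OF \<phi>] star_homD[OF \<psi>] hom_zero[OF \<phi>] hom_zero[OF \<psi>] in auto)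

end

section \<open>C*-algebras from jointly injective families\<close>

context cstar_algebra
begin

lemmas add_assoc = M.a_assoc
  and add_comm = M.a_comm
  and add_zero_left = M.l_zero

lemma neg_add_self: "x \<in> carrier A \<Longrightarrow> (- 1) \<odot> x \<oplus> x = \<zero>"
  by (simp add: neg_smult[symmetric] M.l_neg)

end

text \<open>
  A structure inherits every C*-algebra axiom from a jointly injective family of maps into
  C*-algebras when its norm is the supremum of the norms of the images: equations can be tested
  under each map, and the norm inequalities survive suprema. Only completeness needs more than
  that: a uniform limit of images must again be an image. Subalgebras, isomorphic
  copies and bounded products are all instances.
\<close>
lemma cstar_algebra_of_joint_embedding:
  fixes C :: "'a cstar" and B :: "'i \<Rightarrow> 'c cstar"
  assumes alg: "\<And>i. i \<in> I \<Longrightarrow> cstar_algebra (B i)"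
    and hom: "\<And>i. i \<in> I \<Longrightarrow> \<phi> i \<in> star_hom C (B i)"
    and zero_hom: "\<And>i. i \<in> I \<Longrightarrow> \<phi> i \<zero>\<^bsub>C\<^esub> = \<zero>\<^bsub>B i\<^esub>"
    and inj: "\<And>x y. x \<in> carrier C \<Longrightarrow> y \<in> carrier C \<Longrightarrow> (\<And>i. i \<in> I \<Longrightarrow> \<phi> i x = \<phi> i y) \<Longrightarrow> x = y"
    and closed: "\<zero>\<^bsub>C\<^esub> \<in> carrier C"
      "\<And>x y. x \<in> carrier C \<Longrightarrow> y \<in> carrier C \<Longrightarrow> x \<oplus>\<^bsub>C\<^esub> y \<in> carrier C"
      "\<And>c x. x \<in> carrier C \<Longrightarrow> c \<odot>\<^bsub>C\<^esub> x \<in> carrier C"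
      "\<And>x y. x \<in> carrier C \<Longrightarrow> y \<in> carrier C \<Longrightarrow> x \<otimes>\<^bsub>C\<^esub> y \<in> carrier C"
      "\<And>x. x \<in> carrier C \<Longrightarrow> star C x \<in> carrier C"
    and norm: "\<And>x M. x \<in> carrier C \<Longrightarrow>
      cnorm C x \<le> M \<longleftrightarrow> 0 \<le> M \<and> (\<forall>i\<in>I. cnorm (B i) (\<phi> i x) \<le> M)"
    and limits: "\<And>x l. range x \<subseteq> carrier C \<Longrightarrow>
      (\<And>e. e > 0 \<Longrightarrow> \<exists>N. \<forall>m\<ge>N. \<forall>n\<ge>N. \<forall>i\<in>I. cnorm (B i) (\<phi> i (x m) \<ominus>\<^bsub>B i\<^esub> \<phi> i (x n)) < e) \<Longrightarrow>
      (\<And>i. i \<in> I \<Longrightarrow> cstar_lim (B i) (\<lambda>n. \<phi> i (x n)) (l i)) \<Longrightarrow>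
      \<exists>y\<in>carrier C. \<forall>i\<in>I. \<phi> i y = l i"
  shows "cstar_algebra C"
proof -
  note h = star_homD[OF hom]
  note b = cstar_algebra.add_assoc[OF alg] cstar_algebra.add_zero_left[OF alg]
    cstar_algebra.smult_dist_l[OF alg] cstar_algebra.smult_dist_r[OF alg]
    cstar_algebra.smult_smult[OF alg] cstar_algebra.smult_1[OF alg]
    cstar_algebra.neg_add_self[OF alg] cstar_algebra.mult_assoc[OF alg]
    cstar_algebra.mult_l_distr[OF alg] cstar_algebra.mult_r_distr[OF alg]
    cstar_algebra.smult_mult_l[OF alg] cstar_algebra.smult_mult_r[OF alg]
    cstar_algebra.star_star[OF alg] cstar_algebra.star_add[OF alg]
    cstar_algebra.star_smult[OF alg] cstar_algebra.star_mult[OF alg]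
    cstar_algebra.closed[OF alg] cstar_algebra.smult_in[OF alg]
  have group: "abelian_group C"
  proof (rule abelian_groupI)
    fix x y assume x: "x \<in> carrier C" "y \<in> carrier C"
    show "x \<oplus>\<^bsub>C\<^esub> y = y \<oplus>\<^bsub>C\<^esub> x"
      using x by (rule_tac inj) (simp_all add: closed h cstar_algebra.add_comm[OF alg])
  next
    fix x assume x: "x \<in> carrier C"
    show "\<exists>y\<in>carrier C. y \<oplus>\<^bsub>C\<^esub> x = \<zero>\<^bsub>C\<^esub>"
    proof
      show "(- 1) \<odot>\<^bsub>C\<^esub> x \<oplus>\<^bsub>C\<^esub> x = \<zero>\<^bsub>C\<^esub>"
        using x by (rule_tac inj) (simp_all add: closed h zero_hom b)
    qed (use x closed in simp)
  qed (auto intro!: inj simp: closed h zero_hom b)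
  interpret module "ring_of_type_algebra :: complex ring" C
  proof (rule moduleI)
    show "cring (ring_of_type_algebra :: complex ring)" by (rule cring_from_type_algebra)
  qed (auto intro!: inj simp: group closed h b)
  have "(- 1) \<odot>\<^bsub>C\<^esub> y \<oplus>\<^bsub>C\<^esub> y = \<zero>\<^bsub>C\<^esub>" if "y \<in> carrier C" for y
    using that by (rule_tac inj) (simp_all add: closed h zero_hom b)
  then have neg: "\<ominus>\<^bsub>C\<^esub> y = (- 1) \<odot>\<^bsub>C\<^esub> y" if "y \<in> carrier C" for y
    using that M.minus_equality closed by simp
  have hdiff: "\<phi> i (x \<ominus>\<^bsub>C\<^esub> y) = \<phi> i x \<ominus>\<^bsub>B i\<^esub> \<phi> i y"
    if "i \<in> I" "x \<in> carrier C" "y \<in> carrier C" for i x y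
    using that by (simp add: a_minus_def[of C] neg closed h cstar_algebra.diff_smult[OF alg])
  have le: "cnorm (B i) (\<phi> i x) \<le> cnorm C x" if "x \<in> carrier C" "i \<in> I" for x i
    using norm[OF that(1), of "cnorm C x"] that by simp
  have nonneg: "0 \<le> cnorm C x" if "x \<in> carrier C" for x
    using norm[OF that, of "cnorm C x"] by simp
  have leI: "cnorm C x \<le> M"
    if "x \<in> carrier C" "0 \<le> M" "\<And>i. i \<in> I \<Longrightarrow> cnorm (B i) (\<phi> i x) \<le> M" for x M
    using norm[OF that(1), of M] that by simp
  have eq_zero: "cnorm C x = 0 \<longleftrightarrow> x = \<zero>\<^bsub>C\<^esub>" if x: "x \<in> carrier C" for x
  proof
    assume "cnorm C x = 0"
    then have "\<phi> i x = \<zero>\<^bsub>B i\<^esub>" if "i \<in> I" for i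
      using le[OF x that] cstar_algebra.cnorm_nonneg[OF alg[OF that], of "\<phi> i x"]
        cstar_algebra.cnorm_eq_zero[OF alg[OF that], of "\<phi> i x"] h(1)[OF that x] by simp
    then show "x = \<zero>\<^bsub>C\<^esub>" using x by (intro inj) (auto simp: closed zero_hom)
  next
    assume "x = \<zero>\<^bsub>C\<^esub>"
    then have "cnorm C x \<le> 0"
      using x by (intro leI) (auto simp: zero_hom cstar_algebra.cnorm_zero[OF alg])
    then show "cnorm C x = 0" using nonneg[OF x] by simp
  qed
  have triangle: "cnorm C (x \<oplus>\<^bsub>C\<^esub> y) \<le> cnorm C x + cnorm C y"
    if "x \<in> carrier C" "y \<in> carrier C" for x y
  proof (rule leI)
    fix i assume i: "i \<in> I"
    show "cnorm (B i) (\<phi> i (x \<oplus>\<^bsub>C\<^esub> y)) \<le> cnorm C x + cnorm C y"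
      using cstar_algebra.cnorm_triangle[OF alg[OF i], of "\<phi> i x" "\<phi> i y"]
        le[OF that(1) i] le[OF that(2) i] i that by (simp add: h)
  qed (use that nonneg closed in auto)
  have dist: "cnorm C (x \<ominus>\<^bsub>C\<^esub> z) \<le> cnorm C (x \<ominus>\<^bsub>C\<^esub> y) + cnorm C (y \<ominus>\<^bsub>C\<^esub> z)"
    if "x \<in> carrier C" "y \<in> carrier C" "z \<in> carrier C" for x y z
  proof -
    have "(x \<ominus>\<^bsub>C\<^esub> y) \<oplus>\<^bsub>C\<^esub> (y \<ominus>\<^bsub>C\<^esub> z) = x \<ominus>\<^bsub>C\<^esub> z"
      using that
      by (rule_tac inj) (simp_all add: closed h hdiff cstar_algebra.diff_add_diff[OF alg])
    then show ?thesis using triangle[of "x \<ominus>\<^bsub>C\<^esub> y" "y \<ominus>\<^bsub>C\<^esub> z"] that by simp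
  qed
  have sym: "cnorm C (x \<ominus>\<^bsub>C\<^esub> y) \<le> cnorm C (y \<ominus>\<^bsub>C\<^esub> x)"
    if "x \<in> carrier C" "y \<in> carrier C" for x y
    using that le[of "y \<ominus>\<^bsub>C\<^esub> x"]
    by (intro leI) (auto simp: hdiff h nonneg cstar_algebra.cnorm_diff_commute[OF alg])
  have diff0: "x \<ominus>\<^bsub>C\<^esub> y = \<zero>\<^bsub>C\<^esub> \<longleftrightarrow> x = y" if "x \<in> carrier C" "y \<in> carrier C" for x y
  proof
    assume "x \<ominus>\<^bsub>C\<^esub> y = \<zero>\<^bsub>C\<^esub>"
    then have "\<phi> i x \<ominus>\<^bsub>B i\<^esub> \<phi> i y = \<zero>\<^bsub>B i\<^esub>" if "i \<in> I" for i
      using hdiff[of i x y] zero_hom[of i] that \<open>x \<in> carrier C\<close> \<open>y \<in> carrier C\<close> by simp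
    then show "x = y"
      using that by (intro inj) (auto simp: h cstar_algebra.diff_eq_zero[OF alg])
  next
    assume "x = y"
    then show "x \<ominus>\<^bsub>C\<^esub> y = \<zero>\<^bsub>C\<^esub>" using that by (simp add: a_minus_def M.r_neg)
  qed
  let ?d = "\<lambda>x y. if x \<in> carrier C \<and> y \<in> carrier C then cnorm C (x \<ominus>\<^bsub>C\<^esub> y) else 0"
  interpret met: Metric_space "carrier C" ?d
  proof
    show "0 \<le> ?d x y" for x y by (simp add: nonneg)
    show "?d x y = ?d y x" for x y using sym[of x y] sym[of y x] by auto
    show "?d x y = 0 \<longleftrightarrow> x = y" if "x \<in> carrier C" "y \<in> carrier C" for x y
      using that by (simp add: eq_zero diff0)
    show "?d x z \<le> ?d x y + ?d y z"
      if "x \<in> carrier C" "y \<in> carrier C" "z \<in> carrier C" for x y z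
      using that dist by simp
  qed
  have complete: "met.mcomplete"
    unfolding met.mcomplete_def
  proof (intro allI impI)
    fix x assume "met.MCauchy x"
    then have r: "range x \<subseteq> carrier C"
      and C: "\<And>e. e > 0 \<Longrightarrow> \<exists>N. \<forall>m n. N \<le> m \<longrightarrow> N \<le> n \<longrightarrow> ?d (x m) (x n) < e"
      by (simp_all add: met.MCauchy_def)
    have x: "x n \<in> carrier C" for n using r by blast
    have unif: "\<exists>N. \<forall>m\<ge>N. \<forall>n\<ge>N. \<forall>i\<in>I. cnorm (B i) (\<phi> i (x m) \<ominus>\<^bsub>B i\<^esub> \<phi> i (x n)) < e"
      if e: "e > 0" for e
    proof -
      obtain N where N: "\<And>m n. N \<le> m \<Longrightarrow> N \<le> n \<Longrightarrow> cnorm C (x m \<ominus>\<^bsub>C\<^esub> x n) < e"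
        using C[OF e] x by auto
      have "cnorm (B i) (\<phi> i (x m) \<ominus>\<^bsub>B i\<^esub> \<phi> i (x n)) < e"
        if "N \<le> m" "N \<le> n" "i \<in> I" for m n i
        using N[OF that(1,2)] le[of "x m \<ominus>\<^bsub>C\<^esub> x n" i] x that hdiff[of i "x m" "x n"] by simp
      then show ?thesis by blast
    qed
    have "\<exists>l. cstar_lim (B i) (\<lambda>n. \<phi> i (x n)) l" if i: "i \<in> I" for i
    proof -
      interpret b: cstar_algebra "B i" by (rule alg[OF i])
      show ?thesis
      proof (rule b.Cauchy_convergent[of "\<lambda>n. \<phi> i (x n)"])
        show "range (\<lambda>n. \<phi> i (x n)) \<subseteq> carrier (B i)" using h(1)[OF i x] by blast
        show "\<exists>N. \<forall>m\<ge>N. \<forall>n\<ge>N. cnorm (B i) (\<phi> i (x m) \<ominus>\<^bsub>B i\<^esub> \<phi> i (x n)) < e"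
          if "e > 0" for e
          using unif[OF that] i by blast
      qed (rule exI)
    qed
    then obtain l where l: "\<And>i. i \<in> I \<Longrightarrow> cstar_lim (B i) (\<lambda>n. \<phi> i (x n)) (l i)"
      by metis
    have "\<exists>y\<in>carrier C. \<forall>i\<in>I. \<phi> i y = l i"
      by (rule limits[OF r unif l])
    then obtain y where y: "y \<in> carrier C" "\<And>i. i \<in> I \<Longrightarrow> \<phi> i y = l i"
      by blast
    have "\<exists>N. \<forall>n\<ge>N. cnorm C (x n \<ominus>\<^bsub>C\<^esub> y) < e" if e: "e > 0" for e
    proof -
      obtain N where N: "\<And>m n i. N \<le> m \<Longrightarrow> N \<le> n \<Longrightarrow> i \<in> I \<Longrightarrow>
          cnorm (B i) (\<phi> i (x m) \<ominus>\<^bsub>B i\<^esub> \<phi> i (x n)) < e / 4"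
        using unif[of "e / 4"] e by auto
      have "cnorm C (x n \<ominus>\<^bsub>C\<^esub> y) \<le> e / 2" if n: "n \<ge> N" for n
      proof (rule leI)
        fix i assume i: "i \<in> I"
        interpret b: cstar_algebra "B i" by (rule alg[OF i])
        have c: "\<phi> i (x k) \<in> carrier (B i)" "\<phi> i y \<in> carrier (B i)" for k
          using h(1)[OF i x] h(1)[OF i y(1)] by auto
        have "(\<lambda>m. cnorm (B i) (\<phi> i (x m) \<ominus>\<^bsub>B i\<^esub> \<phi> i y)) \<longlonglongrightarrow> 0"
          using l[OF i] y(2)[OF i] by (simp add: cstar_lim_def)
        then have "\<forall>\<^sub>F m in sequentially. cnorm (B i) (\<phi> i (x m) \<ominus>\<^bsub>B i\<^esub> \<phi> i y) < e / 4"
          using e by (intro order_tendstoD(2)) auto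
        then obtain M where M: "\<And>m. m \<ge> M \<Longrightarrow> cnorm (B i) (\<phi> i (x m) \<ominus>\<^bsub>B i\<^esub> \<phi> i y) < e / 4"
          by (auto simp: eventually_sequentially)
        define m where "m = max M N"
        have "cnorm (B i) (\<phi> i (x m) \<ominus>\<^bsub>B i\<^esub> \<phi> i y) < e / 4"
          using M[of m] by (simp add: m_def)
        moreover have "cnorm (B i) (\<phi> i (x n) \<ominus>\<^bsub>B i\<^esub> \<phi> i (x m)) < e / 4"
          using N[of n m i] n i by (simp add: m_def)
        ultimately have "cnorm (B i) (\<phi> i (x n) \<ominus>\<^bsub>B i\<^esub> \<phi> i y) \<le> e / 2"
          using b.cnorm_diff_triangle[OF c(1) c(1) c(2), of n m] by simp
        then show "cnorm (B i) (\<phi> i (x n \<ominus>\<^bsub>C\<^esub> y)) \<le> e / 2"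
          using hdiff[OF i x y(1)] by simp
      qed (use x y e in auto)
      then have "\<forall>n\<ge>N. cnorm C (x n \<ominus>\<^bsub>C\<^esub> y) < e" using e by force
      then show ?thesis by blast
    qed
    then have "limitin met.mtopology x y sequentially"
      unfolding met.limit_metric_sequentially using x y(1) by auto
    then show "\<exists>y. limitin met.mtopology x y sequentially" by blast
  qed
  show ?thesis
  proof
    fix c x assume x: "x \<in> carrier C"
    have le_smult: "cnorm C (d \<odot>\<^bsub>C\<^esub> y) \<le> cmod d * cnorm C y" if "y \<in> carrier C" for d y
      using that le
      by (intro leI) (auto simp: closed nonneg h cstar_algebra.cnorm_smult[OF alg] mult_left_mono)
    show "cnorm C (c \<odot>\<^bsub>C\<^esub> x) = cmod c * cnorm C x"
    proof (cases "c = 0")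
      case True
      then show ?thesis using le_smult[OF x, of c] nonneg[of "c \<odot>\<^bsub>C\<^esub> x"] x closed by simp
    next
      case False
      have "x = inverse c \<odot>\<^bsub>C\<^esub> (c \<odot>\<^bsub>C\<^esub> x)"
        using x False by (rule_tac inj) (simp_all add: closed h b)
      then have "cnorm C x \<le> inverse (cmod c) * cnorm C (c \<odot>\<^bsub>C\<^esub> x)"
        using le_smult[of "c \<odot>\<^bsub>C\<^esub> x" "inverse c"] x closed by (simp add: norm_inverse)
      then show ?thesis using le_smult[OF x, of c] False by (simp add: field_simps)
    qed
  next
    fix x assume x: "x \<in> carrier C"
    show "cnorm C (star C x \<otimes>\<^bsub>C\<^esub> x) = (cnorm C x)\<^sup>2"
    proof (rule antisym)
      have id: "cnorm (B i) (\<phi> i (star C x \<otimes>\<^bsub>C\<^esub> x)) = (cnorm (B i) (\<phi> i x))\<^sup>2" if "i \<in> I" for i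
        using that x by (simp add: closed h cstar_algebra.cstar_identity[OF alg])
      show "cnorm C (star C x \<otimes>\<^bsub>C\<^esub> x) \<le> (cnorm C x)\<^sup>2"
        using x le[OF x]
        by (intro leI)
           (auto simp: closed id intro!: power_mono cstar_algebra.cnorm_nonneg[OF alg] h(1))
      have "cnorm C x \<le> sqrt (cnorm C (star C x \<otimes>\<^bsub>C\<^esub> x))"
        using x le[of "star C x \<otimes>\<^bsub>C\<^esub> x"]
        by (intro leI) (auto simp: closed id nonneg intro!: real_le_rsqrt)
      then show "(cnorm C x)\<^sup>2 \<le> cnorm C (star C x \<otimes>\<^bsub>C\<^esub> x)"
        using x nonneg closed by (metis real_sqrt_le_iff real_sqrt_abs abs_of_nonneg)
    qed
  next
    fix x y assume x: "x \<in> carrier C" "y \<in> carrier C"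
    show "cnorm C (x \<otimes>\<^bsub>C\<^esub> y) \<le> cnorm C x * cnorm C y"
    proof (rule leI)
      fix i assume i: "i \<in> I"
      have "cnorm (B i) (\<phi> i x \<otimes>\<^bsub>B i\<^esub> \<phi> i y) \<le> cnorm (B i) (\<phi> i x) * cnorm (B i) (\<phi> i y)"
        using x i by (simp add: cstar_algebra.cnorm_mult[OF alg] h)
      also have "\<dots> \<le> cnorm C x * cnorm C y"
        using x i le nonneg h(1)[OF i] cstar_algebra.cnorm_nonneg[OF alg[OF i]]
        by (intro mult_mono) auto
      finally show "cnorm (B i) (\<phi> i (x \<otimes>\<^bsub>C\<^esub> y)) \<le> cnorm C x * cnorm C y"
        using x i by (simp add: h)
    qed (use x closed nonneg in auto)
  next
    show "mcomplete_of (cstar_metric C)"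
      using complete by (simp add: cstar_metric_def)
  qed (auto intro!: inj simp: closed h b nonneg eq_zero triangle)
qed

lemma cstar_algebra_of_isometric_embedding:
  fixes C :: "'a cstar" and B :: "'c cstar"
  assumes alg: "cstar_algebra B" and hom: "\<phi> \<in> star_hom C B"
    and zero: "\<phi> \<zero>\<^bsub>C\<^esub> = \<zero>\<^bsub>B\<^esub>" and inj: "inj_on \<phi> (carrier C)"
    and closed: "\<zero>\<^bsub>C\<^esub> \<in> carrier C"
      "\<And>x y. x \<in> carrier C \<Longrightarrow> y \<in> carrier C \<Longrightarrow> x \<oplus>\<^bsub>C\<^esub> y \<in> carrier C"
      "\<And>c x. x \<in> carrier C \<Longrightarrow> c \<odot>\<^bsub>C\<^esub> x \<in> carrier C"
      "\<And>x y. x \<in> carrier C \<Longrightarrow> y \<in> carrier C \<Longrightarrow> x \<otimes>\<^bsub>C\<^esub> y \<in> carrier C"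
      "\<And>x. x \<in> carrier C \<Longrightarrow> star C x \<in> carrier C"
    and norm: "\<And>x. x \<in> carrier C \<Longrightarrow> cnorm C x = cnorm B (\<phi> x)"
    and limits: "\<And>x l. range x \<subseteq> \<phi> ` carrier C \<Longrightarrow> cstar_lim B x l \<Longrightarrow> l \<in> \<phi> ` carrier C"
  shows "cstar_algebra C"
proof (rule cstar_algebra_of_joint_embedding[where I = "UNIV :: unit set" and B = "\<lambda>_. B"
      and \<phi> = "\<lambda>_. \<phi>"])
  show "cnorm C x \<le> M \<longleftrightarrow> 0 \<le> M \<and> (\<forall>i\<in>(UNIV :: unit set). cnorm B (\<phi> x) \<le> M)"
    if "x \<in> carrier C" for x M
    using norm[OF that] cstar_algebra.cnorm_nonneg[OF alg star_homD(1)[OF hom that]] by auto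
  show "\<exists>y\<in>carrier C. \<forall>i\<in>(UNIV :: unit set). \<phi> y = l i"
    if "range x \<subseteq> carrier C" "\<And>i. i \<in> (UNIV :: unit set) \<Longrightarrow> cstar_lim B (\<lambda>n. \<phi> (x n)) (l i)" for x l
  proof -
    have "l () \<in> \<phi> ` carrier C" using limits[of "\<lambda>n. \<phi> (x n)" "l ()"] that by auto
    then show ?thesis by (metis (full_types) image_iff unit.exhaust)
  qed
qed (use assms in \<open>auto simp: inj_on_def\<close>)

section \<open>Generated C*-algebras\<close>

lemma (in cstar_algebra) restrict_cstar_algebra:
  assumes V: "cstar_subalgebra A V"
  shows "cstar_algebra (A\<lparr>carrier := V\<rparr>)"
  by (rule cstar_algebra_of_isometric_embedding[OF cstar_algebra_axioms, where \<phi> = "\<lambda>x. x"])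
     (use V in \<open>auto simp: subalgebra_iff star_hom_def\<close>)

lemma (in cstar_algebra) restrict_lim:
  assumes V: "cstar_subalgebra A V" and x: "range x \<subseteq> V" "l \<in> V" "cstar_lim A x l"
  shows "cstar_lim (A\<lparr>carrier := V\<rparr>) x l"
proof -
  interpret cstar_pair "A\<lparr>carrier := V\<rparr>" A
    using restrict_cstar_algebra[OF V] cstar_algebra_axioms by (simp add: cstar_pair_def)
  have "(\<lambda>x. x) \<in> star_hom (A\<lparr>carrier := V\<rparr>) A"
    using V by (auto simp: subalgebra_iff star_hom_def)
  then have "x n \<ominus>\<^bsub>A\<lparr>carrier := V\<rparr>\<^esub> l = x n \<ominus> l" for n
    using hom_diff[of "\<lambda>x. x" "x n" l] x by auto
  then show ?thesis using x by (simp add: cstar_lim_def)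
qed

lemma (in cstar_algebra) subalgebra_trans:
  assumes V: "cstar_subalgebra A V" and W: "cstar_subalgebra (A\<lparr>carrier := V\<rparr>) W"
  shows "cstar_subalgebra A W"
proof -
  interpret V: cstar_algebra "A\<lparr>carrier := V\<rparr>" by (rule restrict_cstar_algebra[OF V])
  have "l \<in> W" if x: "range x \<subseteq> W" "cstar_lim A x l" for x l
  proof -
    have "range x \<subseteq> V" using x(1) W by (auto simp: V.subalgebra_iff)
    moreover from this have "l \<in> V" using x(2) V by (auto simp: subalgebra_iff)
    ultimately have "cstar_lim (A\<lparr>carrier := V\<rparr>) x l" using restrict_lim[OF V] x(2) by blast
    then show ?thesis using x(1) W by (auto simp: V.subalgebra_iff)
  qed
  then show ?thesis using V W by (auto simp: V.subalgebra_iff subalgebra_iff)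
qed

lemma carrier_cstar_generated [simp]: "carrier (cstar_generated A W) = cstar_subalgebra A hull W"
  by (simp add: cstar_generated_def)

lemma cstar_generated_simps [simp]:
  "\<zero>\<^bsub>cstar_generated A W\<^esub> = \<zero>\<^bsub>A\<^esub>" "x \<oplus>\<^bsub>cstar_generated A W\<^esub> y = x \<oplus>\<^bsub>A\<^esub> y"
  "c \<odot>\<^bsub>cstar_generated A W\<^esub> x = c \<odot>\<^bsub>A\<^esub> x" "x \<otimes>\<^bsub>cstar_generated A W\<^esub> y = x \<otimes>\<^bsub>A\<^esub> y"
  "star (cstar_generated A W) x = star A x" "cnorm (cstar_generated A W) x = cnorm A x"
  by (simp_all add: cstar_generated_def)

lemma generated_cstar_algebra:
  assumes "cstar_algebra A" "W \<subseteq> carrier A"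
  shows "cstar_algebra (cstar_generated A W)"
  using cstar_algebra.restrict_cstar_algebra[OF assms(1)] cstar_algebra.subalgebra_hull[OF assms]
  by (simp add: cstar_generated_def)

lemma generated_inclusion:
  assumes "cstar_algebra A" "W \<subseteq> carrier A"
  shows "(\<lambda>x. x) \<in> star_hom (cstar_generated A W) A"
  using cstar_algebra.subalgebra_hull[OF assms] cstar_algebra.subalgebra_iff[OF assms(1)]
  by (auto simp: star_hom_def)

text \<open>
  The induction principle for generated C*-algebras: a C*-subalgebra of the generated algebra is
  also one of the ambient algebra, among which the generated algebra is the smallest.
\<close>
lemma generated_induct:
  assumes A: "cstar_algebra A" "W \<subseteq> carrier A"
    and V: "cstar_subalgebra (cstar_generated A W) V" "W \<subseteq> V"
  shows "V = carrier (cstar_generated A W)"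
proof
  have "cstar_subalgebra A V"
    using cstar_algebra.subalgebra_trans[OF A(1) cstar_algebra.subalgebra_hull[OF A]] V(1)
    by (simp add: cstar_generated_def)
  then show "carrier (cstar_generated A W) \<subseteq> V" using V(2) by (simp add: hull_minimal)
  show "V \<subseteq> carrier (cstar_generated A W)"
    using V(1) cstar_algebra.subalgebra_iff[OF generated_cstar_algebra[OF A], of V]
    by (simp only: simp_thms)
qed

lemma generated_generated:
  assumes "cstar_algebra A" "W \<subseteq> carrier A"
  shows "cstar_generated (cstar_generated A W) W = cstar_generated A W"
proof -
  interpret G: cstar_algebra "cstar_generated A W" by (rule generated_cstar_algebra[OF assms])
  have "W \<subseteq> carrier (cstar_generated A W)" by (simp add: hull_subset)
  then have "cstar_subalgebra (cstar_generated A W) hull W = carrier (cstar_generated A W)"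
    by (intro generated_induct[OF assms] G.subalgebra_hull hull_subset)
  then show ?thesis by (simp add: cstar_generated_def)
qed

text \<open>
  The preimage of a C*-subalgebra under a *-homomorphism is closed because *-homomorphisms are
  contractive, so the images of the generators determine where the whole algebra goes.
\<close>
lemma generated_hom_restrict:
  assumes A: "cstar_algebra A" "W \<subseteq> carrier A" and B: "cstar_algebra B" "Y \<subseteq> carrier B"
    and \<phi>: "\<phi> \<in> star_hom (cstar_generated A W) B" "\<phi> ` W \<subseteq> Y"
  shows "\<phi> \<in> star_hom (cstar_generated A W) (cstar_generated B Y)"
proof -
  interpret cstar_pair "cstar_generated A W" B
    using generated_cstar_algebra[OF A] B by (simp add: cstar_pair_def)
  let ?V = "{x \<in> carrier (cstar_generated A W). \<phi> x \<in> cstar_subalgebra B hull Y}"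
  have "W \<subseteq> carrier (cstar_generated A W)" "Y \<subseteq> cstar_subalgebra B hull Y"
    by (simp_all add: hull_subset)
  then have "W \<subseteq> ?V" using \<phi>(2) by blast
  then have "?V = carrier (cstar_generated A W)"
    by (intro generated_induct[OF A] hom_preimage_subalgebra[OF \<phi>(1)] cstar_algebra.subalgebra_hull[OF B])
  then have "\<phi> ` carrier (cstar_generated A W) \<subseteq> carrier (cstar_generated B Y)"
    by auto
  then show ?thesis using \<phi>(1) by (auto simp: star_hom_def)
qed

lemma generated_hom_eq:
  assumes A: "cstar_algebra A" "W \<subseteq> carrier A" and B: "cstar_algebra B"
    and "\<phi> \<in> star_hom (cstar_generated A W) B" "\<psi> \<in> star_hom (cstar_generated A W) B"
    and "\<And>x. x \<in> W \<Longrightarrow> \<phi> x = \<psi> x" "x \<in> carrier (cstar_generated A W)"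
  shows "\<phi> x = \<psi> x"
proof -
  interpret cstar_pair "cstar_generated A W" B
    using generated_cstar_algebra[OF A] B by (simp add: cstar_pair_def)
  have "W \<subseteq> {x \<in> carrier (cstar_generated A W). \<phi> x = \<psi> x}"
    using assms(6) by (auto simp: hull_inc)
  then have "{x \<in> carrier (cstar_generated A W). \<phi> x = \<psi> x} = carrier (cstar_generated A W)"
    by (intro generated_induct[OF A] hom_equalizer_subalgebra assms(4,5))
  then show ?thesis using assms(7) by blast
qed

section \<open>Isomorphic copies and bounded products\<close>

text \<open>
  The copy of \<open>A\<close> on the image of \<open>g\<close>, meant for \<open>g\<close> injective on the carrier.
\<close>
definition transport :: "('a \<Rightarrow> 'd) \<Rightarrow> 'a cstar \<Rightarrow> 'd cstar" where
  "transport g A = (let h = inv_into (carrier A) g in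
     \<lparr>carrier = g ` carrier A, monoid.mult = \<lambda>x y. g (h x \<otimes>\<^bsub>A\<^esub> h y),
      monoid.one = g \<one>\<^bsub>A\<^esub>, ring.zero = g \<zero>\<^bsub>A\<^esub>,
      ring.add = \<lambda>x y. g (h x \<oplus>\<^bsub>A\<^esub> h y), module.smult = \<lambda>c x. g (c \<odot>\<^bsub>A\<^esub> h x),
      star = \<lambda>x. g (star A (h x)), cnorm = \<lambda>x. cnorm A (h x)\<rparr>)"

lemma transport:
  assumes A: "cstar_algebra A" and g: "inj_on g (carrier A)"
  shows "cstar_algebra (transport g A)"
    and "g \<in> star_iso A (transport g A)"
    and "inv_into (carrier A) g \<in> star_hom (transport g A) A"
proof -
  interpret cstar_algebra A by (rule A)
  let ?h = "inv_into (carrier A) g"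
  note [simp] = inv_into_f_f[OF g]
  show iso: "g \<in> star_iso A (transport g A)"
    using g by (auto simp: star_iso_def star_hom_def transport_def Let_def inj_on_imp_bij_betw)
  show hom: "?h \<in> star_hom (transport g A) A"
    by (auto simp: star_hom_def transport_def Let_def)
  have im: "?h ` carrier (transport g A) = carrier A"
    by (force simp: transport_def Let_def image_image)
  show "cstar_algebra (transport g A)"
  proof (rule cstar_algebra_of_isometric_embedding[OF A hom])
    show "inj_on ?h (carrier (transport g A))" by (auto simp: inj_on_def transport_def Let_def)
    show "l \<in> ?h ` carrier (transport g A)" if "cstar_lim A x l" for x l
      using that unfolding im by (simp add: cstar_lim_def)
  qed (auto simp: transport_def Let_def)
qed

text \<open>
  The \<open>l\<^sup>\<infinity>\<close>-product of a family of C*-algebras. The 0 that is added to the set of norms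
  makes the supremum meaningful for the empty family.
\<close>
definition bounded_product :: "'i set \<Rightarrow> ('i \<Rightarrow> 'a cstar) \<Rightarrow> ('i \<Rightarrow> 'a) cstar" where
  "bounded_product I B =
     \<lparr>carrier = {f \<in> \<Pi>\<^sub>E i\<in>I. carrier (B i). \<exists>M. \<forall>i\<in>I. cnorm (B i) (f i) \<le> M},
      monoid.mult = \<lambda>f g. \<lambda>i\<in>I. f i \<otimes>\<^bsub>B i\<^esub> g i, monoid.one = \<lambda>i\<in>I. \<one>\<^bsub>B i\<^esub>, ring.zero = \<lambda>i\<in>I. \<zero>\<^bsub>B i\<^esub>,
     ring.add = \<lambda>f g. \<lambda>i\<in>I. f i \<oplus>\<^bsub>B i\<^esub> g i, module.smult = \<lambda>c f. \<lambda>i\<in>I. c \<odot>\<^bsub>B i\<^esub> f i,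
      star = \<lambda>f. \<lambda>i\<in>I. star (B i) (f i),
      cnorm = \<lambda>f. Sup (insert 0 ((\<lambda>i. cnorm (B i) (f i)) ` I))\<rparr>"

lemma bounded_product_projection:
  assumes "i \<in> I"
  shows "(\<lambda>f. f i) \<in> star_hom (bounded_product I B) (B i)"
  using assms by (auto simp: star_hom_def bounded_product_def)

lemma bounded_product_ext:
  assumes "f \<in> carrier (bounded_product I B)" "g \<in> carrier (bounded_product I B)"
    and "\<And>i. i \<in> I \<Longrightarrow> f i = g i"
  shows "f = g"
  using assms by (auto simp: bounded_product_def intro: PiE_ext)

lemma bounded_product_cstar_algebra:
  assumes alg: "\<And>i. i \<in> I \<Longrightarrow> cstar_algebra (B i)"
  shows "cstar_algebra (bounded_product I B)"
proof (rule cstar_algebra_of_joint_embedding[where I = I and B = B and \<phi> = "\<lambda>i f. f i"])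
  let ?C = "bounded_product I B"
  note b = cstar_algebra.closed[OF alg] cstar_algebra.smult_in[OF alg]
  show "cstar_algebra (B i)" if "i \<in> I" for i by (rule alg[OF that])
  show "(\<lambda>f. f i) \<in> star_hom ?C (B i)" if "i \<in> I" for i
    by (rule bounded_product_projection[OF that])
  show "\<zero>\<^bsub>?C\<^esub> i = \<zero>\<^bsub>B i\<^esub>" if "i \<in> I" for i using that by (simp add: bounded_product_def)
  show "f = g" if "f \<in> carrier ?C" "g \<in> carrier ?C" "\<And>i. i \<in> I \<Longrightarrow> f i = g i" for f g
    by (rule bounded_product_ext[OF that])
  show "\<zero>\<^bsub>?C\<^esub> \<in> carrier ?C"
    by (auto simp: bounded_product_def b cstar_algebra.cnorm_zero[OF alg] intro!: exI[of _ 0])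
  fix f assume f: "f \<in> carrier ?C"
  then have fi: "f i \<in> carrier (B i)" if "i \<in> I" for i
    using that by (auto simp: bounded_product_def)
  obtain M where M: "\<And>i. i \<in> I \<Longrightarrow> cnorm (B i) (f i) \<le> M"
    using f by (auto simp: bounded_product_def)
  show "c \<odot>\<^bsub>?C\<^esub> f \<in> carrier ?C" for c
  proof -
    have "cnorm (B i) (c \<odot>\<^bsub>B i\<^esub> f i) \<le> cmod c * M" if "i \<in> I" for i
      using that M fi by (simp add: cstar_algebra.cnorm_smult[OF alg] mult_left_mono)
    then show ?thesis using fi by (auto simp: bounded_product_def b)
  qed
  show "star ?C f \<in> carrier ?C"
    using fi M by (auto simp: bounded_product_def b cstar_algebra.cnorm_star[OF alg])
  show "cnorm ?C f \<le> K \<longleftrightarrow> 0 \<le> K \<and> (\<forall>i\<in>I. cnorm (B i) (f i) \<le> K)" for K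
  proof -
    have "bdd_above (insert 0 ((\<lambda>i. cnorm (B i) (f i)) ` I))"
      using M by (auto intro!: bdd_aboveI)
    then show ?thesis by (simp add: bounded_product_def cSup_le_iff)
  qed
  fix g assume g: "g \<in> carrier ?C"
  then have gi: "g i \<in> carrier (B i)" if "i \<in> I" for i
    using that by (auto simp: bounded_product_def)
  obtain K where K: "\<And>i. i \<in> I \<Longrightarrow> cnorm (B i) (g i) \<le> K"
    using g by (auto simp: bounded_product_def)
  have "cnorm (B i) (f i \<oplus>\<^bsub>B i\<^esub> g i) \<le> M + K" if i: "i \<in> I" for i
    using cstar_algebra.cnorm_triangle[OF alg[OF i] fi[OF i] gi[OF i]] M[OF i] K[OF i] by simp
  then show "f \<oplus>\<^bsub>?C\<^esub> g \<in> carrier ?C" using fi gi by (auto simp: bounded_product_def b)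
  have "cnorm (B i) (f i \<otimes>\<^bsub>B i\<^esub> g i) \<le> \<bar>M\<bar> * \<bar>K\<bar>" if i: "i \<in> I" for i
  proof -
    interpret b: cstar_algebra "B i" by (rule alg[OF i])
    have "cnorm (B i) (f i \<otimes>\<^bsub>B i\<^esub> g i) \<le> cnorm (B i) (f i) * cnorm (B i) (g i)"
      using fi gi i by (intro b.cnorm_mult)
    also have "\<dots> \<le> \<bar>M\<bar> * \<bar>K\<bar>"
      using M[OF i] K[OF i] fi[OF i] gi[OF i] by (intro mult_mono) (auto simp: b.cnorm_nonneg)
    finally show ?thesis .
  qed
  then show "f \<otimes>\<^bsub>?C\<^esub> g \<in> carrier ?C" using fi gi by (auto simp: bounded_product_def b)
next
  let ?C = "bounded_product I B"
  fix x :: "nat \<Rightarrow> 'a \<Rightarrow> 'b" and l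
  assume r: "range x \<subseteq> carrier ?C"
    and C: "\<And>e. e > 0 \<Longrightarrow> \<exists>N. \<forall>m\<ge>N. \<forall>n\<ge>N. \<forall>i\<in>I. cnorm (B i) (x m i \<ominus>\<^bsub>B i\<^esub> x n i) < e"
    and l: "\<And>i. i \<in> I \<Longrightarrow> cstar_lim (B i) (\<lambda>n. x n i) (l i)"
  obtain N where N: "\<And>m n i. N \<le> m \<Longrightarrow> N \<le> n \<Longrightarrow> i \<in> I \<Longrightarrow>
      cnorm (B i) (x m i \<ominus>\<^bsub>B i\<^esub> x n i) < 1"
    using C[of 1] by auto
  have "x N \<in> carrier ?C" using r by blast
  then obtain M where M: "\<And>i. i \<in> I \<Longrightarrow> cnorm (B i) (x N i) \<le> M"
    by (auto simp: bounded_product_def)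
  \<comment> \<open>The pointwise limit is bounded, since from \<open>N\<close> on all terms are within distance 1 of \<open>x N\<close>.\<close>
  have "cnorm (B i) (l i) \<le> M + 1" if i: "i \<in> I" for i
  proof -
    interpret b: cstar_algebra "B i" by (rule alg[OF i])
    have c: "x n i \<in> carrier (B i)" for n using l[OF i] by (auto simp: cstar_lim_def)
    have "cnorm (B i) (x n i) \<le> M + 1" if "n \<ge> N" for n
      using b.cnorm_diff_le[OF c c, of n N] N[of n N i] that i M[OF i] by simp
    then show ?thesis using b.lim_norm[OF l[OF i]] by (intro LIMSEQ_le_const2) auto
  qed
  then have "restrict l I \<in> carrier ?C"
    using l by (auto simp: bounded_product_def cstar_lim_def)
  then show "\<exists>y\<in>carrier ?C. \<forall>i\<in>I. y i = l i" by (intro bexI[of _ "restrict l I"]) auto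
qed

section \<open>Density of polynomials\<close>

context cstar_algebra
begin

text \<open>
  As there may be no unit, the empty word has the value 0; products of words with nonempty
  factors correspond to concatenation.
\<close>
fun word_value :: "('x \<Rightarrow> 'a) \<Rightarrow> 'x list \<Rightarrow> 'a" where
  "word_value e [] = \<zero>"
| "word_value e [a] = e a"
| "word_value e (a # b # w) = e a \<otimes> word_value e (b # w)"

primrec poly_value :: "('x \<Rightarrow> 'a) \<Rightarrow> (complex \<times> 'x list) list \<Rightarrow> 'a" where
  "poly_value e [] = \<zero>"
| "poly_value e (t # ts) = fst t \<odot> word_value e (snd t) \<oplus> poly_value e ts"

lemma word_value_closed: "range e \<subseteq> carrier A \<Longrightarrow> word_value e w \<in> carrier A"
  by (induction e w rule: word_value.induct) (auto simp: image_subset_iff)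

lemma poly_value_closed: "range e \<subseteq> carrier A \<Longrightarrow> poly_value e ts \<in> carrier A"
  by (induction ts) (auto simp: word_value_closed)

lemma word_value_append:
  assumes e: "range e \<subseteq> carrier A" and "u \<noteq> []" "v \<noteq> []"
  shows "word_value e (u @ v) = word_value e u \<otimes> word_value e v"
  using assms(2,3)
proof (induction u rule: induct_list012)
  case (2 a)
  then show ?case by (cases v) auto
next
  case (3 a b w)
  then show ?case using e by (simp add: mult_assoc word_value_closed[OF e] image_subset_iff)
qed simp

lemma word_value_mult:
  assumes e: "range e \<subseteq> carrier A"
  shows "word_value e u \<otimes> word_value e v \<in> range (word_value e)"
proof (cases "u = [] \<or> v = []")
  case True
  then have "word_value e u \<otimes> word_value e v = word_value e []"
    using word_value_closed[OF e] by auto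
  then show ?thesis by blast
next
  case False
  then show ?thesis using word_value_append[OF e, of u v] by (metis rangeI)
qed

lemma word_value_star:
  assumes e: "range e \<subseteq> carrier A" and st: "\<And>a. star A (e a) \<in> range e"
  shows "star A (word_value e w) \<in> range (word_value e)"
proof -
  have letter: "star A (e a) \<in> range (word_value e)" for a
  proof -
    obtain b where "star A (e a) = e b" using st[of a] by blast
    then have "star A (e a) = word_value e [b]" by simp
    then show ?thesis by blast
  qed
  show ?thesis
  proof (induction w rule: induct_list012)
    case 1
    show ?case using rangeI[of "word_value e" "[]"] by simp
  next
    case (2 a)
    show ?case using letter by simp
  next
    case (3 a b w)
    have "star A (word_value e (a # b # w)) = star A (word_value e (b # w)) \<otimes> star A (e a)"
      using e by (simp add: star_mult word_value_closed[OF e] image_subset_iff)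
    then show ?case using word_value_mult[OF e] letter[of a] 3(2) by (metis (no_types, lifting) rangeE)
  qed
qed

lemma poly_value_append:
  assumes e: "range e \<subseteq> carrier A"
  shows "poly_value e (ts @ us) = poly_value e ts \<oplus> poly_value e us"
  by (induction ts) (auto simp: add_assoc word_value_closed[OF e] poly_value_closed[OF e])

lemma poly_value_add:
  assumes e: "range e \<subseteq> carrier A" and "x \<in> range (poly_value e)" "y \<in> range (poly_value e)"
  shows "x \<oplus> y \<in> range (poly_value e)"
  using assms(2,3) poly_value_append[OF e] by (metis (no_types, lifting) rangeE rangeI)

lemma poly_value_word:
  assumes e: "range e \<subseteq> carrier A" and "x \<in> range (word_value e)"
  shows "c \<odot> x \<in> range (poly_value e)"
proof -
  obtain w where "x = word_value e w" using assms(2) by blast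
  then have "c \<odot> x = poly_value e [(c, w)]" using word_value_closed[OF e] by simp
  then show ?thesis by blast
qed

lemma poly_value_smult:
  assumes e: "range e \<subseteq> carrier A"
  shows "c \<odot> poly_value e ts \<in> range (poly_value e)"
proof (induction ts)
  case Nil
  show ?case using rangeI[of "poly_value e" "[]"] by simp
next
  case (Cons t ts)
  have "c \<odot> poly_value e (t # ts) = (c * fst t) \<odot> word_value e (snd t) \<oplus> c \<odot> poly_value e ts"
    using word_value_closed[OF e] poly_value_closed[OF e] by (simp add: smult_dist_r)
  then show ?case using poly_value_add[OF e] poly_value_word[OF e] Cons by simp
qed

lemma poly_value_mult:
  assumes e: "range e \<subseteq> carrier A"
  shows "poly_value e ts \<otimes> poly_value e us \<in> range (poly_value e)"
proof (induction ts)
  case Nil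
  show ?case using rangeI[of "poly_value e" "[]"] poly_value_closed[OF e] by simp
next
  case (Cons t ts)
  note c = word_value_closed[OF e] poly_value_closed[OF e]
  have word: "word_value e w \<otimes> poly_value e us \<in> range (poly_value e)" for w
  proof (induction us)
    case Nil
    show ?case using rangeI[of "poly_value e" "[]"] c by simp
  next
    case (Cons u us)
    have "word_value e w \<otimes> poly_value e (u # us) =
        fst u \<odot> (word_value e w \<otimes> word_value e (snd u)) \<oplus> word_value e w \<otimes> poly_value e us"
      using c by (simp add: mult_r_distr smult_mult_r)
    then show ?case using poly_value_add[OF e] poly_value_word[OF e] word_value_mult[OF e] Cons
      by simp
  qed
  have "poly_value e (t # ts) \<otimes> poly_value e us =
      fst t \<odot> (word_value e (snd t) \<otimes> poly_value e us) \<oplus> poly_value e ts \<otimes> poly_value e us"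
    using c by (simp add: mult_l_distr smult_mult_l)
  moreover have "fst t \<odot> (word_value e (snd t) \<otimes> poly_value e us) \<in> range (poly_value e)"
    using word[of "snd t"] poly_value_smult[OF e] by (metis (no_types, lifting) rangeE)
  ultimately show ?case using poly_value_add[OF e] Cons by simp
qed

lemma poly_value_star:
  assumes e: "range e \<subseteq> carrier A" and st: "\<And>a. star A (e a) \<in> range e"
  shows "star A (poly_value e ts) \<in> range (poly_value e)"
proof (induction ts)
  case Nil
  show ?case using rangeI[of "poly_value e" "[]"] by simp
next
  case (Cons t ts)
  have "star A (poly_value e (t # ts)) =
      cnj (fst t) \<odot> star A (word_value e (snd t)) \<oplus> star A (poly_value e ts)"
    using word_value_closed[OF e] poly_value_closed[OF e] by (simp add: star_add star_smult)
  then show ?case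
    using poly_value_add[OF e] poly_value_word[OF e] word_value_star[OF e st] Cons by simp
qed

text \<open>
  The values of polynomials in a family of letters closed under the involution form a *-subalgebra,
  and the generated C*-algebra lies in its closure.
\<close>
lemma polynomials_dense:
  assumes e: "range e \<subseteq> carrier A" and st: "\<And>a. star A (e a) \<in> range e"
    and z: "z \<in> cstar_subalgebra A hull (range e)"
  shows "\<exists>ts. cstar_lim A (\<lambda>n. poly_value e (ts n)) z"
proof -
  let ?W = "range (poly_value e)"
  let ?V = "{l. \<exists>x. range x \<subseteq> ?W \<and> cstar_lim A x l}"
  have "\<zero> \<in> ?W" using rangeI[of "poly_value e" "[]"] by simp
  then have "cstar_subalgebra A ?V"
    using poly_value_closed[OF e] poly_value_add[OF e] poly_value_smult[OF e]
      poly_value_mult[OF e] poly_value_star[OF e st]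
    by (intro subalgebra_closure) blast+
  moreover have "e a \<in> ?V" for a
  proof -
    have "e a = poly_value e [(1, [a])]" using e by (simp add: image_subset_iff)
    then have "e a \<in> ?W" by blast
    moreover have "e a \<in> carrier A" using e by blast
    ultimately show ?thesis
      using lim_const[of "e a"] by (auto intro!: exI[of _ "\<lambda>_. e a"])
  qed
  ultimately have "cstar_subalgebra A hull (range e) \<subseteq> ?V" by (intro hull_minimal) auto
  then obtain x where x: "range x \<subseteq> ?W" "cstar_lim A x z" using z by blast
  then have "\<forall>n. \<exists>t. x n = poly_value e t" by blast
  then obtain ts where "\<And>n. x n = poly_value e (ts n)" by metis
  then have "x = (\<lambda>n. poly_value e (ts n))" by blast
  then show ?thesis using x(2) by blast
qed

end

section \<open>Representations and *-homomorphisms\<close>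

lemma finsum_infinite: "infinite Y \<Longrightarrow> finsum G f Y = \<zero>\<^bsub>G\<^esub>"
  by (simp add: finsum_def finprod_def)

lemma (in cstar_pair) hom_finsum:
  assumes \<phi>: "\<phi> \<in> star_hom A B" and f: "f \<in> Y \<rightarrow> carrier A" and g: "\<And>y. y \<in> Y \<Longrightarrow> \<phi> (f y) = g y"
  shows "\<phi> (finsum A f Y) = finsum B g Y"
proof (cases "finite Y")
  case True
  then show ?thesis using f g
  proof (induction Y rule: finite_induct)
    case empty
    then show ?case by (simp add: hom_zero[OF \<phi>])
  next
    case (insert y Y)
    have y: "f y \<in> carrier A" "f \<in> Y \<rightarrow> carrier A" using insert.prems(1) by auto
    have g: "g y \<in> carrier B" "g \<in> Y \<rightarrow> carrier B"
      using insert.prems star_homD(1)[OF \<phi>] by (auto simp: Pi_iff) metis+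
    have "\<phi> (finsum A f (insert y Y)) = \<phi> (f y \<oplus>\<^bsub>A\<^esub> finsum A f Y)"
      using insert.hyps y by (simp add: A.M.finsum_insert)
    also have "\<dots> = g y \<oplus>\<^bsub>B\<^esub> finsum B g Y"
      using y insert.IH insert.prems by (simp add: star_homD[OF \<phi>] A.M.finsum_closed)
    also have "\<dots> = finsum B g (insert y Y)"
      using insert.hyps g by (simp add: B.M.finsum_insert)
    finally show ?case .
  qed
next
  case False
  then show ?thesis by (simp add: finsum_infinite hom_zero[OF \<phi>])
qed

lemma representation_closed:
  assumes "representation L \<theta> A P S"
  shows "cstar_algebra A" "P b \<in> carrier A" "\<alpha> \<in> L \<Longrightarrow> S \<alpha> \<in> carrier A"
  using assms by (auto simp: representation_def is_projection_def is_partial_isometry_def)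

lemma representation_generators:
  "representation L \<theta> A P S \<Longrightarrow> range P \<union> S ` L \<subseteq> carrier A"
  by (auto dest: representation_closed)

text \<open>
  The defining relations of a representation are equations between algebraic expressions (finite
  sums included), so they hold as soon as they hold under a jointly injective family of
  *-homomorphisms.
\<close>
lemma representation_of_joint_embedding:
  fixes C :: "'a cstar" and B :: "'i \<Rightarrow> 'c cstar"
    and \<theta> :: "'l \<Rightarrow> 'b::generalized_boolean_algebra \<Rightarrow> 'b"
  assumes C: "cstar_algebra C"
    and hom: "\<And>i. i \<in> I \<Longrightarrow> \<phi> i \<in> star_hom C (B i)"
    and inj: "\<And>x y. x \<in> carrier C \<Longrightarrow> y \<in> carrier C \<Longrightarrow> (\<And>i. i \<in> I \<Longrightarrow> \<phi> i x = \<phi> i y) \<Longrightarrow> x = y"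
    and P: "\<And>b. P b \<in> carrier C" and S: "\<And>\<alpha>. \<alpha> \<in> L \<Longrightarrow> S \<alpha> \<in> carrier C"
    and rep: "\<And>i. i \<in> I \<Longrightarrow> representation L \<theta> (B i) (\<lambda>b. \<phi> i (P b)) (\<lambda>\<alpha>. \<phi> i (S \<alpha>))"
  shows "representation L \<theta> C P S"
proof -
  interpret C: cstar_algebra C by (rule C)
  note h = star_homD[OF hom]
  have pair: "cstar_pair C (B i)" if "i \<in> I" for i
    using C representation_closed(1)[OF rep[OF that]] by (simp add: cstar_pair_def)
  note h0 = cstar_pair.hom_zero[OF pair hom] and hd = cstar_pair.hom_diff[OF pair hom]
  note r = rep[unfolded representation_def]
  have p: "is_projection (B i) (\<phi> i (P b))"
    "\<alpha> \<in> L \<Longrightarrow> is_partial_isometry (B i) (\<phi> i (S \<alpha>))"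
    "\<phi> i (P b) \<otimes>\<^bsub>B i\<^esub> \<phi> i (P b') = \<phi> i (P (inf b b'))"
    "\<phi> i (P (sup b b')) = \<phi> i (P b) \<oplus>\<^bsub>B i\<^esub> \<phi> i (P b') \<ominus>\<^bsub>B i\<^esub> \<phi> i (P (inf b b'))"
    "\<phi> i (P bot) = \<zero>\<^bsub>B i\<^esub>"
    "\<alpha> \<in> L \<Longrightarrow> \<phi> i (P b) \<otimes>\<^bsub>B i\<^esub> \<phi> i (S \<alpha>) = \<phi> i (S \<alpha>) \<otimes>\<^bsub>B i\<^esub> \<phi> i (P (\<theta> \<alpha> b))"
    "\<alpha> \<in> L \<Longrightarrow> \<beta> \<in> L \<Longrightarrow> star (B i) (\<phi> i (S \<alpha>)) \<otimes>\<^bsub>B i\<^esub> \<phi> i (S \<beta>) =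
        (if \<alpha> = \<beta> then \<phi> i (P (range_top (\<theta> \<alpha>))) else \<zero>\<^bsub>B i\<^esub>)"
    "regular_element L \<theta> b \<Longrightarrow> \<phi> i (P b) = finsum (B i)
        (\<lambda>\<alpha>. \<phi> i (S \<alpha>) \<otimes>\<^bsub>B i\<^esub> \<phi> i (P (\<theta> \<alpha> b)) \<otimes>\<^bsub>B i\<^esub> star (B i) (\<phi> i (S \<alpha>))) (Delta L \<theta> b)"
    if "i \<in> I" for i b b' \<alpha> \<beta>
    using r[OF that] by simp_all
  show ?thesis unfolding representation_def
  proof (intro conjI allI ballI impI)
    show "is_projection C (P b)" for b
      using P p(1) unfolding is_projection_def by (auto intro!: inj simp: h)
    show "is_partial_isometry C (S \<alpha>)" if "\<alpha> \<in> L" for \<alpha>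
      using S[OF that] p(2)[OF _ that] unfolding is_partial_isometry_def
      by (auto intro!: inj simp: h)
    show "P b \<otimes>\<^bsub>C\<^esub> P b' = P (inf b b')" for b b'
      using P by (intro inj) (auto simp: h p(3))
    show "P (sup b b') = P b \<oplus>\<^bsub>C\<^esub> P b' \<ominus>\<^bsub>C\<^esub> P (inf b b')" for b b'
      using P by (intro inj) (auto simp: h hd p(4))
    show "P bot = \<zero>\<^bsub>C\<^esub>" using P by (intro inj) (auto simp: h0 p(5))
    show "P b \<otimes>\<^bsub>C\<^esub> S \<alpha> = S \<alpha> \<otimes>\<^bsub>C\<^esub> P (\<theta> \<alpha> b)" if "\<alpha> \<in> L" for \<alpha> b
      using P S that by (intro inj) (auto simp: h p(6))
    show "star C (S \<alpha>) \<otimes>\<^bsub>C\<^esub> S \<beta> = (if \<alpha> = \<beta> then P (range_top (\<theta> \<alpha>)) else \<zero>\<^bsub>C\<^esub>)"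
      if "\<alpha> \<in> L" "\<beta> \<in> L" for \<alpha> \<beta>
      using P S that by (intro inj) (auto simp: h h0 p(7))
    fix b assume reg: "regular_element L \<theta> b"
    let ?f = "\<lambda>\<alpha>. S \<alpha> \<otimes>\<^bsub>C\<^esub> P (\<theta> \<alpha> b) \<otimes>\<^bsub>C\<^esub> star C (S \<alpha>)"
    have f: "?f \<in> Delta L \<theta> b \<rightarrow> carrier C" using P S by (auto simp: Delta_def)
    show "P b = finsum C ?f (Delta L \<theta> b)"
    proof (rule inj)
      fix i assume i: "i \<in> I"
      show "\<phi> i (P b) = \<phi> i (finsum C ?f (Delta L \<theta> b))"
        unfolding p(8)[OF i reg]
        by (rule cstar_pair.hom_finsum[OF pair[OF i] hom[OF i] f, symmetric])
           (use P S i in \<open>auto simp: h Delta_def\<close>)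
    qed (use P f C.M.finsum_closed in auto)
  qed (rule C)
qed

lemma representation_hom:
  fixes \<theta> :: "'l \<Rightarrow> 'b::generalized_boolean_algebra \<Rightarrow> 'b"
  assumes rep: "representation L \<theta> A P S" and B: "cstar_algebra B" and \<phi>: "\<phi> \<in> star_hom A B"
  shows "representation L \<theta> B (\<lambda>b. \<phi> (P b)) (\<lambda>\<alpha>. \<phi> (S \<alpha>))"
proof -
  interpret cstar_pair A B
    using B representation_closed(1)[OF rep] by (simp add: cstar_pair_def)
  note h = star_homD[OF \<phi>] and r = rep[unfolded representation_def]
  note c [simp] = representation_closed(2,3)[OF rep]
  have p: "star A (P b) = P b" "P b \<otimes>\<^bsub>A\<^esub> P b' = P (inf b b')"
    "P (sup b b') = P b \<oplus>\<^bsub>A\<^esub> P b' \<ominus>\<^bsub>A\<^esub> P (inf b b')" "P bot = \<zero>\<^bsub>A\<^esub>"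
    "\<alpha> \<in> L \<Longrightarrow> S \<alpha> \<otimes>\<^bsub>A\<^esub> star A (S \<alpha>) \<otimes>\<^bsub>A\<^esub> S \<alpha> = S \<alpha>"
    "\<alpha> \<in> L \<Longrightarrow> P b \<otimes>\<^bsub>A\<^esub> S \<alpha> = S \<alpha> \<otimes>\<^bsub>A\<^esub> P (\<theta> \<alpha> b)"
    "\<alpha> \<in> L \<Longrightarrow> \<beta> \<in> L \<Longrightarrow> star A (S \<alpha>) \<otimes>\<^bsub>A\<^esub> S \<beta> = (if \<alpha> = \<beta> then P (range_top (\<theta> \<alpha>)) else \<zero>\<^bsub>A\<^esub>)"
    "regular_element L \<theta> b \<Longrightarrow> P b = finsum A
        (\<lambda>\<alpha>. S \<alpha> \<otimes>\<^bsub>A\<^esub> P (\<theta> \<alpha> b) \<otimes>\<^bsub>A\<^esub> star A (S \<alpha>)) (Delta L \<theta> b)" for b b' \<alpha> \<beta>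
    using r by (simp_all add: is_projection_def is_partial_isometry_def)
  show ?thesis unfolding representation_def
  proof (intro conjI allI ballI impI)
    show "is_projection B (\<phi> (P b))" for b
      using p(1,2) by (simp add: is_projection_def h flip: h(4,5))
    show "is_partial_isometry B (\<phi> (S \<alpha>))" if "\<alpha> \<in> L" for \<alpha>
      using that p(5) by (simp add: is_partial_isometry_def h(1) flip: h(4,5))
    show "\<phi> (P b) \<otimes>\<^bsub>B\<^esub> \<phi> (P b') = \<phi> (P (inf b b'))" for b b'
      by (simp add: p flip: h(4))
    show "\<phi> (P (sup b b')) = \<phi> (P b) \<oplus>\<^bsub>B\<^esub> \<phi> (P b') \<ominus>\<^bsub>B\<^esub> \<phi> (P (inf b b'))" for b b'
      by (simp add: p(3) hom_diff[OF \<phi>] h(2))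
    show "\<phi> (P bot) = \<zero>\<^bsub>B\<^esub>" by (simp add: p(4) hom_zero[OF \<phi>])
    show "\<phi> (P b) \<otimes>\<^bsub>B\<^esub> \<phi> (S \<alpha>) = \<phi> (S \<alpha>) \<otimes>\<^bsub>B\<^esub> \<phi> (P (\<theta> \<alpha> b))" if "\<alpha> \<in> L" for \<alpha> b
      using that by (simp add: p(6) flip: h(4))
    show "star B (\<phi> (S \<alpha>)) \<otimes>\<^bsub>B\<^esub> \<phi> (S \<beta>) = (if \<alpha> = \<beta> then \<phi> (P (range_top (\<theta> \<alpha>))) else \<zero>\<^bsub>B\<^esub>)"
      if "\<alpha> \<in> L" "\<beta> \<in> L" for \<alpha> \<beta>
      using that by (simp add: p(7) hom_zero[OF \<phi>] flip: h(4,5))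
    fix b assume reg: "regular_element L \<theta> b"
    show "\<phi> (P b) = finsum B (\<lambda>\<alpha>. \<phi> (S \<alpha>) \<otimes>\<^bsub>B\<^esub> \<phi> (P (\<theta> \<alpha> b)) \<otimes>\<^bsub>B\<^esub> star B (\<phi> (S \<alpha>))) (Delta L \<theta> b)"
      by (subst p(8)[OF reg], rule hom_finsum[OF \<phi>]) (auto simp: h Delta_def)
  qed (rule B)
qed

section \<open>The C*-algebra generated by a representation\<close>

lemma rep_algebra_inclusion:
  "representation L \<theta> A P S \<Longrightarrow> (\<lambda>x. x) \<in> star_hom (rep_algebra L A P S) A"
  unfolding rep_algebra_def
  by (intro generated_inclusion representation_generators) (rule representation_closed(1))

lemma rep_algebra_cstar_algebra:
  "representation L \<theta> A P S \<Longrightarrow> cstar_algebra (rep_algebra L A P S)"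
  unfolding rep_algebra_def
  by (intro generated_cstar_algebra representation_generators) (rule representation_closed(1))

lemma rep_algebra_generators:
  "P b \<in> carrier (rep_algebra L A P S)" "\<alpha> \<in> L \<Longrightarrow> S \<alpha> \<in> carrier (rep_algebra L A P S)"
  by (simp_all add: rep_algebra_def hull_inc)

lemma representation_in_rep_algebra:
  fixes \<theta> :: "'l \<Rightarrow> 'b::generalized_boolean_algebra \<Rightarrow> 'b"
  assumes "representation L \<theta> A P S"
  shows "representation L \<theta> (rep_algebra L A P S) P S"
  by (rule representation_of_joint_embedding[where I = "UNIV :: unit set" and B = "\<lambda>_. A"
        and \<phi> = "\<lambda>_ x. x"])
     (use assms in \<open>auto simp: rep_algebra_cstar_algebra rep_algebra_inclusion rep_algebra_generators\<close>)

lemma rep_algebra_rep_algebra: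
  assumes "representation L \<theta> A P S"
  shows "rep_algebra L (rep_algebra L A P S) P S = rep_algebra L A P S"
  unfolding rep_algebra_def
  by (rule generated_generated[OF representation_closed(1)[OF assms] representation_generators[OF assms]])

lemma rep_algebra_hom_restrict:
  assumes "representation L \<theta> C p s" "representation L \<theta> A P S"
    and "\<pi> \<in> star_hom (rep_algebra L C p s) A" "\<And>b. \<pi> (p b) = P b" "\<And>\<alpha>. \<alpha> \<in> L \<Longrightarrow> \<pi> (s \<alpha>) = S \<alpha>"
  shows "\<pi> \<in> star_hom (rep_algebra L C p s) (rep_algebra L A P S)"
  unfolding rep_algebra_def
  by (rule generated_hom_restrict)
     (use assms in \<open>auto simp: rep_algebra_def representation_closed\<close>)

text \<open>
  Labels outside \<open>L\<close> stand for 0, so that every word has a value in the algebra.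
\<close>
definition letter_value :: "'l set \<Rightarrow> 'a cstar \<Rightarrow> ('b \<Rightarrow> 'a) \<Rightarrow> ('l \<Rightarrow> 'a) \<Rightarrow> 'b + 'l + 'l \<Rightarrow> 'a" where
  "letter_value L A P S x = (case x of
      Inl b \<Rightarrow> P b
    | Inr (Inl \<alpha>) \<Rightarrow> (if \<alpha> \<in> L then S \<alpha> else \<zero>\<^bsub>A\<^esub>)
    | Inr (Inr \<alpha>) \<Rightarrow> (if \<alpha> \<in> L then star A (S \<alpha>) else \<zero>\<^bsub>A\<^esub>))"

text \<open>
  Every letter is a partial isometry, hence of the form letter times an element of the algebra; this
  turns one-letter words into products in the proof of nondegeneracy.
\<close>
lemma letter_value_laws:
  assumes rep: "representation L \<theta> A P S"
  shows "range (letter_value L A P S) \<subseteq> carrier A"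
    and "star A (letter_value L A P S x) \<in> range (letter_value L A P S)"
    and "letter_value L A P S x \<otimes>\<^bsub>A\<^esub> (star A (letter_value L A P S x) \<otimes>\<^bsub>A\<^esub> letter_value L A P S x) =
      letter_value L A P S x"
proof -
  interpret cstar_algebra A by (rule representation_closed(1)[OF rep])
  note c [simp] = representation_closed(2,3)[OF rep]
  have p: "star A (P b) = P b" "P b \<otimes>\<^bsub>A\<^esub> P b = P b"
    "\<alpha> \<in> L \<Longrightarrow> S \<alpha> \<otimes>\<^bsub>A\<^esub> star A (S \<alpha>) \<otimes>\<^bsub>A\<^esub> S \<alpha> = S \<alpha>" for b \<alpha>
    using rep by (simp_all add: representation_def is_projection_def is_partial_isometry_def)
  let ?e = "letter_value L A P S"
  have inl: "?e (Inl b) = P b" for b by (simp add: letter_value_def)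
  have inrl: "?e (Inr (Inl \<alpha>)) = (if \<alpha> \<in> L then S \<alpha> else \<zero>\<^bsub>A\<^esub>)" for \<alpha> by (simp add: letter_value_def)
  have inrr: "?e (Inr (Inr \<alpha>)) = (if \<alpha> \<in> L then star A (S \<alpha>) else \<zero>\<^bsub>A\<^esub>)" for \<alpha>
    by (simp add: letter_value_def)
  have closed: "?e x \<in> carrier A" for x
    by (auto simp: letter_value_def split: sum.split)
  then show "range ?e \<subseteq> carrier A" by blast
  have "\<exists>y. star A (?e x) = ?e y"
  proof -
    consider b where "x = Inl b" | \<alpha> where "x = Inr (Inl \<alpha>)" | \<alpha> where "x = Inr (Inr \<alpha>)"
      by (metis sum.exhaust)
    then show ?thesis
    proof cases
      case 1
      then have "star A (?e x) = ?e (Inl b)" by (simp add: inl p)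
      then show ?thesis ..
    next
      case 2
      then have "star A (?e x) = ?e (Inr (Inr \<alpha>))" by (simp add: inrl inrr)
      then show ?thesis ..
    next
      case 3
      then have "star A (?e x) = ?e (Inr (Inl \<alpha>))" by (simp add: inrl inrr star_star)
      then show ?thesis ..
    qed
  qed
  then show "star A (?e x) \<in> range ?e" by auto
  have "star A (S \<alpha>) \<otimes>\<^bsub>A\<^esub> (S \<alpha> \<otimes>\<^bsub>A\<^esub> star A (S \<alpha>)) = star A (S \<alpha>)" if "\<alpha> \<in> L" for \<alpha>
    using arg_cong[OF p(3)[OF that], of "star A"] that by (simp add: star_mult star_star)
  then show "?e x \<otimes>\<^bsub>A\<^esub> (star A (?e x) \<otimes>\<^bsub>A\<^esub> ?e x) = ?e x"
    using p(3) by (auto simp: letter_value_def p star_star mult_assoc split: sum.split)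
qed

lemma rep_algebra_dense:
  assumes rep: "representation L \<theta> A P S" and z: "z \<in> carrier (rep_algebra L A P S)"
  shows "\<exists>ts. cstar_lim A (\<lambda>n. cstar_algebra.poly_value A (letter_value L A P S) (ts n)) z"
proof -
  interpret cstar_algebra A by (rule representation_closed(1)[OF rep])
  let ?e = "letter_value L A P S"
  have "P b = ?e (Inl b)" for b by (simp add: letter_value_def)
  moreover have "S \<alpha> = ?e (Inr (Inl \<alpha>))" if "\<alpha> \<in> L" for \<alpha> using that by (simp add: letter_value_def)
  ultimately have "range P \<union> S ` L \<subseteq> range ?e" by blast
  then have "z \<in> cstar_subalgebra A hull (range ?e)"
    using z hull_mono[of "range P \<union> S ` L" "range ?e" "cstar_subalgebra A"]
    by (auto simp: rep_algebra_def)
  then show ?thesis using letter_value_laws(1,2)[OF rep] by (intro polynomials_dense)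
qed

text \<open>
  Choosing for each element a sequence of formal polynomials whose values converge to it embeds the
  generated algebra into the type of such sequences, since limits are unique. Hence that type
  carries a copy of every representation.
\<close>
lemma representation_copy:
  fixes L :: "'l set" and \<theta> :: "'l \<Rightarrow> 'b::generalized_boolean_algebra \<Rightarrow> 'b" and A :: "'a cstar"
  assumes rep: "representation L \<theta> A P S"
  obtains B :: "('b, 'l) star_poly_seq cstar" and Q T h
  where "representation L \<theta> B Q T" "h \<in> star_hom B (rep_algebra L A P S)"
    "\<And>b. h (Q b) = P b" "\<And>\<alpha>. \<alpha> \<in> L \<Longrightarrow> h (T \<alpha>) = S \<alpha>"
proof -
  interpret cstar_algebra A by (rule representation_closed(1)[OF rep])
  let ?R = "rep_algebra L A P S"
  let ?v = "\<lambda>ts :: ('b, 'l) star_poly_seq. \<lambda>n. poly_value (letter_value L A P S) (ts n)"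
  obtain g :: "'a \<Rightarrow> ('b, 'l) star_poly_seq" where g: "\<And>z. z \<in> carrier ?R \<Longrightarrow> cstar_lim A (?v (g z)) z"
    using rep_algebra_dense[OF rep] by metis
  have inj: "inj_on g (carrier ?R)"
  proof (rule inj_onI)
    fix x y assume "x \<in> carrier ?R" "y \<in> carrier ?R" "g x = g y"
    then show "x = y" using g[of x] g[of y] by (simp add: lim_unique)
  qed
  note tr = transport[OF rep_algebra_cstar_algebra[OF rep] inj]
  let ?h = "inv_into (carrier ?R) g"
  have "g \<in> star_hom ?R (transport g ?R)" using tr(2) by (simp add: star_iso_def)
  then have "representation L \<theta> (transport g ?R) (\<lambda>b. g (P b)) (\<lambda>\<alpha>. g (S \<alpha>))"
    by (rule representation_hom[OF representation_in_rep_algebra[OF rep] tr(1)])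
  moreover have "?h (g (P b)) = P b" for b
    by (intro inv_into_f_f[OF inj] rep_algebra_generators)
  moreover have "?h (g (S \<alpha>)) = S \<alpha>" if "\<alpha> \<in> L" for \<alpha>
    by (intro inv_into_f_f[OF inj] rep_algebra_generators that)
  ultimately show thesis using that tr(3) by blast
qed

text \<open>
  The closed span of the products \<open>\<pi>(x) y\<close> contains the value of every word: a letter is the image of
  a generator, and a one-letter word \<open>a\<close> is the product \<open>a (a* a)\<close>. It therefore contains all
  polynomials, which are dense.
\<close>
lemma rep_algebra_hom_nondegenerate:
  assumes C: "representation L \<theta> C p s" and A: "representation L \<theta> A P S"
    and \<pi>: "\<pi> \<in> star_hom (rep_algebra L C p s) A" "\<And>b. \<pi> (p b) = P b" "\<And>\<alpha>. \<alpha> \<in> L \<Longrightarrow> \<pi> (s \<alpha>) = S \<alpha>"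
  shows "nondegenerate (rep_algebra L C p s) (rep_algebra L A P S) \<pi>"
proof -
  let ?D = "rep_algebra L C p s" and ?B = "rep_algebra L A P S"
  have hom: "\<pi> \<in> star_hom ?D ?B" by (rule rep_algebra_hom_restrict[OF C A \<pi>])
  have B: "representation L \<theta> ?B P S" by (rule representation_in_rep_algebra[OF A])
  have D: "representation L \<theta> ?D p s" by (rule representation_in_rep_algebra[OF C])
  interpret cstar_pair ?D ?B
    using representation_closed(1)[OF B] representation_closed(1)[OF D] by (simp add: cstar_pair_def)
  let ?G = "{\<pi> x \<otimes>\<^bsub>?B\<^esub> y | x y. x \<in> carrier ?D \<and> y \<in> carrier ?B}"
  let ?H = "closed_span ?B ?G"
  let ?e = "letter_value L ?B P S"
  note e = letter_value_laws[OF B]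
  have G: "?G \<subseteq> carrier ?B" using star_homD(1)[OF hom] by auto
  have H: "closed_subspace ?B ?H" by (rule B.closed_subspace_hull[OF G])
  then have H': "?H \<subseteq> carrier ?B" "\<zero>\<^bsub>?B\<^esub> \<in> ?H" "\<And>x y. x \<in> ?H \<Longrightarrow> y \<in> ?H \<Longrightarrow> x \<oplus>\<^bsub>?B\<^esub> y \<in> ?H"
    "\<And>c x. x \<in> ?H \<Longrightarrow> c \<odot>\<^bsub>?B\<^esub> x \<in> ?H"
    "\<And>x l. range x \<subseteq> ?H \<Longrightarrow> cstar_lim ?B x l \<Longrightarrow> l \<in> ?H"
    unfolding B.closed_subspace_iff by simp_all
  have GH: "?G \<subseteq> ?H" unfolding closed_span_def by (rule hull_subset)
  have eB: "?e a \<in> carrier ?B" for a using e(1) by blast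
  have letter: "?e a \<otimes>\<^bsub>?B\<^esub> y \<in> ?H" if "y \<in> carrier ?B" for a y
  proof -
    have "?e a = \<pi> (letter_value L ?D p s a)"
      using hom_zero[OF hom] star_homD(5)[OF hom] \<pi>(2,3) representation_closed(3)[OF D]
      by (auto simp: letter_value_def split: sum.split)
    moreover have "letter_value L ?D p s a \<in> carrier ?D" using letter_value_laws(1)[OF D] by blast
    ultimately have "?e a \<otimes>\<^bsub>?B\<^esub> y \<in> ?G"
      using that by (intro CollectI exI[of _ "letter_value L ?D p s a"] exI[of _ y]) simp
    then show ?thesis using GH by (rule rev_subsetD)
  qed
  have word: "B.word_value ?e w \<in> ?H" for w
  proof (cases w rule: remdups_adj.cases)
    case 1
    then show ?thesis using H'(2) by simp
  next
    case (2 a)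
    then show ?thesis using letter[of "star ?B (?e a) \<otimes>\<^bsub>?B\<^esub> ?e a" a] eB by (simp add: e(3))
  next
    case (3 a b u)
    then show ?thesis using letter B.word_value_closed[OF e(1)] by simp
  qed
  have poly: "B.poly_value ?e ts \<in> ?H" for ts
    by (induction ts) (simp_all add: H' word)
  have "z \<in> ?H" if "z \<in> carrier ?B" for z
  proof -
    have "\<exists>ts. cstar_lim ?B (\<lambda>n. B.poly_value ?e (ts n)) z"
      using \<open>z \<in> carrier ?B\<close> by (intro rep_algebra_dense[OF B]) (simp only: rep_algebra_rep_algebra[OF A])
    then obtain ts where ts: "cstar_lim ?B (\<lambda>n. B.poly_value ?e (ts n)) z" ..
    have "range (\<lambda>n. B.poly_value ?e (ts n)) \<subseteq> ?H" using poly by (rule image_subsetI)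
    then show ?thesis using ts by (rule H'(5))
  qed
  then show ?thesis using H'(1) by (auto simp: nondegenerate_def)
qed

section \<open>The universal representation\<close>

lemma universal_representationI:
  fixes U :: "'u cstar" and \<theta> :: "'l \<Rightarrow> 'b::generalized_boolean_algebra \<Rightarrow> 'b"
  assumes U: "representation L \<theta> U p s"
    and hom: "\<And>(A :: 'c cstar) P S. representation L \<theta> A P S \<Longrightarrow>
      \<exists>\<pi>\<in>star_hom (rep_algebra L U p s) A. (\<forall>b. \<pi> (p b) = P b) \<and> (\<forall>\<alpha>\<in>L. \<pi> (s \<alpha>) = S \<alpha>)"
  shows "universal_representation TYPE('c) L \<theta> U p s"
  unfolding universal_representation_def
proof (intro conjI allI impI)
  fix A :: "'c cstar" and P S assume A: "representation L \<theta> A P S"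
  obtain \<pi> where \<pi>: "\<pi> \<in> star_hom (rep_algebra L U p s) A" "\<forall>b. \<pi> (p b) = P b" "\<forall>\<alpha>\<in>L. \<pi> (s \<alpha>) = S \<alpha>"
    using hom[OF A] by blast
  then have "nondegenerate (rep_algebra L U p s) (rep_algebra L A P S) \<pi>"
    by (intro rep_algebra_hom_nondegenerate[OF U A]) auto
  with \<pi> show "\<exists>\<pi>\<in>star_hom (rep_algebra L U p s) A.
      nondegenerate (rep_algebra L U p s) (rep_algebra L A P S) \<pi> \<and>
      (\<forall>A. \<pi> (p A) = P A) \<and> (\<forall>\<alpha>\<in>L. \<pi> (s \<alpha>) = S \<alpha>)" by blast
qed (rule U)

text \<open>
  The direct sum of all representations on the type of polynomial sequences is a representation in the
  bounded product of the target algebras; the coordinate projections give the homomorphisms that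
  universality asks for. The product lives on a larger type, so the algebra that it generates is
  copied back.
\<close>
lemma universal_representation_exists:
  fixes L :: "'l set" and \<theta> :: "'l \<Rightarrow> 'b::generalized_boolean_algebra \<Rightarrow> 'b"
  shows "\<exists>(U :: ('b, 'l) star_poly_seq cstar) p s.
    universal_representation TYPE(('b, 'l) star_poly_seq) L \<theta> U p s"
proof -
  define I where "I = {(A :: ('b, 'l) star_poly_seq cstar, P, S). representation L \<theta> A P S}"
  define D where "D = bounded_product I fst"
  define p where "p b = (\<lambda>i\<in>I. fst (snd i) b)" for b
  define s where "s \<alpha> = (\<lambda>i\<in>I. snd (snd i) \<alpha>)" for \<alpha>
  have rep: "representation L \<theta> (fst i) (fst (snd i)) (snd (snd i))" if "i \<in> I" for i
    using that by (auto simp: I_def)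
  note c = representation_closed[OF rep]
  have norm: "cnorm (fst i) (fst (snd i) b) \<le> 1"
    "\<alpha> \<in> L \<Longrightarrow> cnorm (fst i) (snd (snd i) \<alpha>) \<le> 1" if i: "i \<in> I" for i b \<alpha>
  proof -
    interpret b: cstar_algebra "fst i" by (rule c(1)[OF i])
    have r: "is_projection (fst i) (fst (snd i) b)"
      "\<alpha> \<in> L \<Longrightarrow> is_partial_isometry (fst i) (snd (snd i) \<alpha>)"
      using rep[OF i] by (simp_all add: representation_def)
    show "cnorm (fst i) (fst (snd i) b) \<le> 1"
      using b.cnorm_partial_isometry b.projection_partial_isometry r(1) by blast
    show "\<alpha> \<in> L \<Longrightarrow> cnorm (fst i) (snd (snd i) \<alpha>) \<le> 1"
      using b.cnorm_partial_isometry r(2) by blast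
  qed
  have D: "representation L \<theta> D p s"
  proof (rule representation_of_joint_embedding[where I = I and B = fst and \<phi> = "\<lambda>i f. f i"])
    show "cstar_algebra D" unfolding D_def by (rule bounded_product_cstar_algebra) (rule c(1))
    show "(\<lambda>f. f i) \<in> star_hom D (fst i)" if "i \<in> I" for i
      unfolding D_def by (rule bounded_product_projection[OF that])
    show "f = g" if "f \<in> carrier D" "g \<in> carrier D" "\<And>i. i \<in> I \<Longrightarrow> f i = g i" for f g
      using that unfolding D_def by (rule bounded_product_ext)
    show "p b \<in> carrier D" for b
      using c(2) norm(1) by (auto simp: D_def p_def bounded_product_def intro!: exI[of _ 1])
    show "s \<alpha> \<in> carrier D" if "\<alpha> \<in> L" for \<alpha>
      using c(3) norm(2) that by (auto simp: D_def s_def bounded_product_def intro!: exI[of _ 1])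
    show "representation L \<theta> (fst i) (\<lambda>b. p b i) (\<lambda>\<alpha>. s \<alpha> i)" if "i \<in> I" for i
      using rep[OF that] that by (simp add: p_def s_def)
  qed
  obtain U :: "('b, 'l) star_poly_seq cstar" and q t h
    where U: "representation L \<theta> U q t" and h: "h \<in> star_hom U (rep_algebra L D p s)"
    and hq: "\<And>b. h (q b) = p b" "\<And>\<alpha>. \<alpha> \<in> L \<Longrightarrow> h (t \<alpha>) = s \<alpha>"
    using representation_copy[OF D] by metis
  have "universal_representation TYPE(('b, 'l) star_poly_seq) L \<theta> U q t"
  proof (rule universal_representationI[OF U])
    fix A :: "('b, 'l) star_poly_seq cstar" and P S assume A: "representation L \<theta> A P S"
    let ?i = "(A, P, S)"
    have i: "?i \<in> I" using A by (simp add: I_def)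
    have "(\<lambda>x. x) \<in> star_hom (rep_algebra L U q t) U" by (rule rep_algebra_inclusion[OF U])
    moreover note h
    moreover have "(\<lambda>x. x) \<in> star_hom (rep_algebra L D p s) D" by (rule rep_algebra_inclusion[OF D])
    moreover have "(\<lambda>f. f ?i) \<in> star_hom D A"
      using bounded_product_projection[OF i, of fst] by (simp add: D_def)
    ultimately have "(\<lambda>f. f ?i) \<circ> ((\<lambda>x. x) \<circ> (h \<circ> (\<lambda>x. x))) \<in> star_hom (rep_algebra L U q t) A"
      by (blast intro: star_hom_comp)
    then show "\<exists>\<pi>\<in>star_hom (rep_algebra L U q t) A. (\<forall>b. \<pi> (q b) = P b) \<and> (\<forall>\<alpha>\<in>L. \<pi> (t \<alpha>) = S \<alpha>)"
      by (rule bexI[rotated]) (use i hq in \<open>simp add: p_def s_def\<close>)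
  qed
  then show ?thesis by blast
qed

text \<open>
  A representation on any type has a copy on the type of polynomial sequences, where universality applies;
  composing with the homomorphism back from the copy gives the required map.
\<close>
lemma universal_representation_any_type:
  fixes L :: "'l set" and \<theta> :: "'l \<Rightarrow> 'b::generalized_boolean_algebra \<Rightarrow> 'b" and U :: "'u cstar"
  assumes univ: "universal_representation TYPE(('b, 'l) star_poly_seq) L \<theta> U p s"
  shows "universal_representation TYPE('c) L \<theta> U p s"
proof (rule universal_representationI)
  show "representation L \<theta> U p s" using univ by (simp add: universal_representation_def)
  fix A :: "'c cstar" and P S assume A: "representation L \<theta> A P S"
  obtain B :: "('b, 'l) star_poly_seq cstar" and Q T h
    where B: "representation L \<theta> B Q T" and h: "h \<in> star_hom B (rep_algebra L A P S)"
    and hQ: "\<And>b. h (Q b) = P b" "\<And>\<alpha>. \<alpha> \<in> L \<Longrightarrow> h (T \<alpha>) = S \<alpha>"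
    using representation_copy[OF A] by metis
  obtain \<pi> where \<pi>: "\<pi> \<in> star_hom (rep_algebra L U p s) B" "\<forall>b. \<pi> (p b) = Q b" "\<forall>\<alpha>\<in>L. \<pi> (s \<alpha>) = T \<alpha>"
    using univ B unfolding universal_representation_def by blast
  have "(\<lambda>x. x) \<circ> (h \<circ> \<pi>) \<in> star_hom (rep_algebra L U p s) A"
    by (rule star_hom_comp[OF star_hom_comp[OF \<pi>(1) h] rep_algebra_inclusion[OF A]])
  then show "\<exists>\<pi>\<in>star_hom (rep_algebra L U p s) A. (\<forall>b. \<pi> (p b) = P b) \<and> (\<forall>\<alpha>\<in>L. \<pi> (s \<alpha>) = S \<alpha>)"
    by (rule bexI[rotated]) (use \<pi> hQ in simp)
qed

text \<open>
  By contractivity, two *-homomorphisms that agree on the generators agree on the closed algebra generated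
  by them.
\<close>
lemma rep_algebra_endomorphism_id:
  assumes rep: "representation L \<theta> A P S" and \<rho>: "\<rho> \<in> star_hom (rep_algebra L A P S) A"
    "\<And>b. \<rho> (P b) = P b" "\<And>\<alpha>. \<alpha> \<in> L \<Longrightarrow> \<rho> (S \<alpha>) = S \<alpha>"
    and x: "x \<in> carrier (rep_algebra L A P S)"
  shows "\<rho> x = x"
  using generated_hom_eq[OF representation_closed(1)[OF rep] representation_generators[OF rep]
      representation_closed(1)[OF rep], of \<rho> "\<lambda>x. x" x] \<rho> x rep_algebra_inclusion[OF rep]
  by (auto simp: rep_algebra_def)

text \<open>
  Universality of each representation gives homomorphisms in both directions; their compositions fix the
  generators and are therefore identities.
\<close>
lemma universal_representation_unique:
  fixes L :: "'l set" and \<theta> :: "'l \<Rightarrow> 'b::generalized_boolean_algebra \<Rightarrow> 'b"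
    and U :: "'u cstar" and V :: "'v cstar"
  assumes U: "universal_representation TYPE('v) L \<theta> U p s"
    and V: "universal_representation TYPE('u) L \<theta> V q t"
  shows "\<exists>\<phi>\<in>star_iso (rep_algebra L U p s) (rep_algebra L V q t).
    (\<forall>A. \<phi> (p A) = q A) \<and> (\<forall>\<alpha>\<in>L. \<phi> (s \<alpha>) = t \<alpha>)"
proof -
  let ?A = "rep_algebra L U p s" and ?B = "rep_algebra L V q t"
  have u: "representation L \<theta> U p s" and v: "representation L \<theta> V q t"
    using U V by (simp_all add: universal_representation_def)
  obtain \<phi> where \<phi>: "\<phi> \<in> star_hom ?A V" "\<forall>b. \<phi> (p b) = q b" "\<forall>\<alpha>\<in>L. \<phi> (s \<alpha>) = t \<alpha>"
    using U v unfolding universal_representation_def by blast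
  obtain \<psi> where \<psi>: "\<psi> \<in> star_hom ?B U" "\<forall>b. \<psi> (q b) = p b" "\<forall>\<alpha>\<in>L. \<psi> (t \<alpha>) = s \<alpha>"
    using V u unfolding universal_representation_def by blast
  have hom: "\<phi> \<in> star_hom ?A ?B" "\<psi> \<in> star_hom ?B ?A"
    using rep_algebra_hom_restrict[OF u v \<phi>(1)] rep_algebra_hom_restrict[OF v u \<psi>(1)] \<phi> \<psi> by auto
  have inv: "\<psi> (\<phi> x) = x" if "x \<in> carrier ?A" for x
  proof -
    have "\<psi> \<circ> \<phi> \<in> star_hom ?A U" by (rule star_hom_comp[OF hom(1) \<psi>(1)])
    then show ?thesis using rep_algebra_endomorphism_id[OF u, of "\<psi> \<circ> \<phi>" x] \<phi> \<psi> that by simp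
  qed
  have inv': "\<phi> (\<psi> x) = x" if "x \<in> carrier ?B" for x
  proof -
    have "\<phi> \<circ> \<psi> \<in> star_hom ?B V" by (rule star_hom_comp[OF hom(2) \<phi>(1)])
    then show ?thesis using rep_algebra_endomorphism_id[OF v, of "\<phi> \<circ> \<psi>" x] \<phi> \<psi> that by simp
  qed
  have "bij_betw \<phi> (carrier ?A) (carrier ?B)"
    by (rule bij_betw_byWitness[where f' = \<psi>]) (use inv inv' star_homD(1) hom in auto)
  then have "\<phi> \<in> star_iso ?A ?B" using hom(1) by (simp add: star_iso_def)
  then show ?thesis using \<phi> by blast
qed

(* First conjunct: existence, tested against one sufficiently large type. Second conjunct: such a
   representation, which does not depend on the type 'c, is universal for the C*-algebras on every
   type 'c. Third conjunct: uniqueness up to an isomorphism matching the generators. *)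
theorem theorem3p8:
  fixes L :: "'l set"
    and \<theta> :: "'l \<Rightarrow> 'b::generalized_boolean_algebra \<Rightarrow> 'b"
  assumes "boolean_dynamical_system L \<theta>"
  shows
    "(\<exists>(U :: ('b, 'l) star_poly_seq cstar) p s.
        universal_representation TYPE(('b, 'l) star_poly_seq) L \<theta> U p s) \<and>
     (\<forall>(U :: 'u cstar) p s.
        universal_representation TYPE(('b, 'l) star_poly_seq) L \<theta> U p s \<longrightarrow>
        universal_representation TYPE('c) L \<theta> U p s) \<and>
     (\<forall>(U :: 'u cstar) p s (V :: 'v cstar) q t.
        universal_representation TYPE(('b, 'l) star_poly_seq) L \<theta> U p s \<and>
        universal_representation TYPE(('b, 'l) star_poly_seq) L \<theta> V q t \<longrightarrow>
        (\<exists>\<phi> \<in> star_iso (rep_algebra L U p s) (rep_algebra L V q t).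
           (\<forall>A. \<phi> (p A) = q A) \<and> (\<forall>\<alpha>\<in>L. \<phi> (s \<alpha>) = t \<alpha>)))"
proof (intro conjI allI impI)
  show "\<exists>(U :: ('b, 'l) star_poly_seq cstar) p s.
      universal_representation TYPE(('b, 'l) star_poly_seq) L \<theta> U p s"
    by (rule universal_representation_exists)
next
  fix U :: "'u cstar" and p s
  assume "universal_representation TYPE(('b, 'l) star_poly_seq) L \<theta> U p s"
  then show "universal_representation TYPE('c) L \<theta> U p s"
    by (rule universal_representation_any_type)
next
  fix U :: "'u cstar" and p s and V :: "'v cstar" and q t
  assume "universal_representation TYPE(('b, 'l) star_poly_seq) L \<theta> U p s \<and>
    universal_representation TYPE(('b, 'l) star_poly_seq) L \<theta> V q t"
  then show "\<exists>\<phi>\<in>star_iso (rep_algebra L U p s) (rep_algebra L V q t).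
      (\<forall>A. \<phi> (p A) = q A) \<and> (\<forall>\<alpha>\<in>L. \<phi> (s \<alpha>) = t \<alpha>)"
    by (intro universal_representation_unique) (auto intro: universal_representation_any_type)
qed

end
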